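(* Let $d\ge 0$ be an integer and let $S(2,d)$ be the Schur algebra over $\mathbb{Q}$ (defined in the context). Then $S(2,d)$ is isomorphic with the associative $\mathbb{Q}$-algebra with $1$ generated by $e,f,H_1$ subject to the relations $$H_1e-eH_1=e,\qquad ef-fe=2H_1-d,\qquad H_1f-fH_1=-f,$$ $$H_1(H_1-1)\cdots(H_1-d)=0.$$ Moreover, this presented algebra has a $\mathbb{Q}$-basis consisting of all $e^a H_1^b f^c$ with $a,b,c$ nonnegative integers such that $a+b+c\le d$.
   Context: Let $E$ be a $2$-dimensional $\mathbb{Q}$-vector space with fixed basis $e_1,e_2$, identifying $GL(E)$ with $GL_2(\mathbb{Q})$. The group $GL_2(\mathbb{Q})$ acts diagonally on $E^{\otimes d}$; extending linearly gives a representation of the group algebra $\mathbb{Q}GL_2(\mathbb{Q})\to\mathrm{End}(E^{\otimes d})$, and the Schur algebra $S(2,d)$ is its image. Equivalently, $S(2,d)$ is the image of the differentiated representation $\rho_d:U(\mathfrak{gl}_2)\to\mathrm{End}(E^{\otimes d})$ of the universal enveloping algebra. *)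

theory Defs
  imports Complex_Main
begin

datatype gen = Ge | Gf | Gh

text \<open>Noncommutative polynomials: functions from words to coefficients;
  elements of the free algebra are those with finite support.\<close>
type_synonym fa = "gen list \<Rightarrow> rat"

definition fa_carrier :: "fa set" where
  "fa_carrier = {p. finite {w. p w \<noteq> 0}}"

definition fa_zero :: fa where "fa_zero = (\<lambda>_. 0)"
definition fa_mon :: "gen list \<Rightarrow> fa" where
  "fa_mon w = (\<lambda>u. if u = w then 1 else 0)"
definition fa_one :: fa where "fa_one = fa_mon []"
definition fa_gen :: "gen \<Rightarrow> fa" where "fa_gen x = fa_mon [x]"
definition fa_add :: "fa \<Rightarrow> fa \<Rightarrow> fa" where "fa_add p q = (\<lambda>w. p w + q w)"
definition fa_diff :: "fa \<Rightarrow> fa \<Rightarrow> fa" where "fa_diff p q = (\<lambda>w. p w - q w)"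
definition fa_smult :: "rat \<Rightarrow> fa \<Rightarrow> fa" where "fa_smult c p = (\<lambda>w. c * p w)"
definition fa_mult :: "fa \<Rightarrow> fa \<Rightarrow> fa" where
  "fa_mult p q = (\<lambda>w. \<Sum>i\<le>length w. p (take i w) * q (drop i w))"

definition rel1 :: fa where
  "rel1 = fa_diff (fa_diff (fa_mult (fa_gen Gh) (fa_gen Ge)) (fa_mult (fa_gen Ge) (fa_gen Gh))) (fa_gen Ge)"
definition rel2 :: "nat \<Rightarrow> fa" where
  "rel2 d = fa_diff (fa_diff (fa_mult (fa_gen Ge) (fa_gen Gf)) (fa_mult (fa_gen Gf) (fa_gen Ge)))
              (fa_diff (fa_smult 2 (fa_gen Gh)) (fa_smult (of_nat d) fa_one))"
definition rel3 :: fa where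
  "rel3 = fa_add (fa_diff (fa_mult (fa_gen Gh) (fa_gen Gf)) (fa_mult (fa_gen Gf) (fa_gen Gh))) (fa_gen Gf)"

primrec hprod :: "nat \<Rightarrow> fa" where
  "hprod 0 = fa_gen Gh"
| "hprod (Suc n) = fa_mult (hprod n) (fa_diff (fa_gen Gh) (fa_smult (of_nat (Suc n)) fa_one))"

definition rels :: "nat \<Rightarrow> fa set" where
  "rels d = {rel1, rel2 d, rel3, hprod d}"

inductive_set fa_ideal :: "fa set \<Rightarrow> fa set" for R :: "fa set" where
  zero: "fa_zero \<in> fa_ideal R"
| add: "p \<in> fa_ideal R \<Longrightarrow> q \<in> fa_ideal R \<Longrightarrow> fa_add p q \<in> fa_ideal R"
| smult: "p \<in> fa_ideal R \<Longrightarrow> fa_smult c p \<in> fa_ideal R"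
| gen: "r \<in> R \<Longrightarrow> fa_mult (fa_mon u) (fa_mult r (fa_mon v)) \<in> fa_ideal R"

definition pbw_mon :: "nat \<Rightarrow> nat \<Rightarrow> nat \<Rightarrow> fa" where
  "pbw_mon a b c = fa_mon (replicate a Ge @ replicate b Gh @ replicate c Gf)"

text \<open>Basis of E^{\<otimes>d}: e_{i_1} \<otimes> ... \<otimes> e_{i_d} indexed by lists over {0,1}
  (0 for e_1, 1 for e_2). Endomorphisms are matrices indexed by such lists,
  zero outside the index set.\<close>
definition tidx :: "nat \<Rightarrow> nat list set" where
  "tidx d = {w. length w = d \<and> set w \<subseteq> {0, 1}}"

type_synonym mat = "nat list \<Rightarrow> nat list \<Rightarrow> rat"

text \<open>A 2x2 rational matrix g (entries g i j, i,j in {0,1}), with g e_j = sum_i g i j e_i.\<close>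
definition gl2 :: "(nat \<Rightarrow> nat \<Rightarrow> rat) \<Rightarrow> bool" where
  "gl2 g \<longleftrightarrow> g 0 0 * g 1 1 - g 0 1 * g 1 0 \<noteq> 0"

definition tensor_power :: "nat \<Rightarrow> (nat \<Rightarrow> nat \<Rightarrow> rat) \<Rightarrow> mat" where
  "tensor_power d g = (\<lambda>i j. if i \<in> tidx d \<and> j \<in> tidx d then \<Prod>k<d. g (i ! k) (j ! k) else 0)"

text \<open>Image of the group algebra Q GL_2(Q) in End(E^{\<otimes>d}).\<close>
definition schur_algebra :: "nat \<Rightarrow> mat set" where
  "schur_algebra d = {M. \<exists>(n::nat) (c::nat \<Rightarrow> rat) g. (\<forall>k<n. gl2 (g k)) \<and>
       M = (\<lambda>i j. \<Sum>k<n. c k * tensor_power d (g k) i j)}"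

definition mat_mult :: "nat \<Rightarrow> mat \<Rightarrow> mat \<Rightarrow> mat" where
  "mat_mult d A B = (\<lambda>i j. \<Sum>k\<in>tidx d. A i k * B k j)"

definition mat_one :: "nat \<Rightarrow> mat" where
  "mat_one d = (\<lambda>i j. if i = j \<and> i \<in> tidx d then 1 else 0)"

definition fa_alg_hom :: "nat \<Rightarrow> (fa \<Rightarrow> mat) \<Rightarrow> bool" where
  "fa_alg_hom d \<psi> \<longleftrightarrow>
     (\<forall>p\<in>fa_carrier. \<forall>q\<in>fa_carrier. \<psi> (fa_add p q) = (\<lambda>i j. \<psi> p i j + \<psi> q i j)) \<and>
     (\<forall>c. \<forall>p\<in>fa_carrier. \<psi> (fa_smult c p) = (\<lambda>i j. c * \<psi> p i j)) \<and>
     (\<forall>p\<in>fa_carrier. \<forall>q\<in>fa_carrier. \<psi> (fa_mult p q) = mat_mult d (\<psi> p) (\<psi> q)) \<and>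
     \<psi> fa_one = mat_one d"

end

theory Submission
  imports Defs "HOL-Library.Function_Algebras" "HOL-Computational_Algebra.Polynomial"
begin

text \<open>
  Filter the presented algebra by word length. The first three relations make the associated graded
  algebra commutative, and commutators with a generator do not raise the degree. The last relation
  puts \<open>H\<^sub>1^(d+1)\<close> into lower degree; commuting it repeatedly with \<open>e\<close> and then with \<open>f\<close> puts every
  \<open>e^a H\<^sub>1^b f^c\<close> with \<open>a + b + c = d + 1\<close> into lower degree, so the monomials of degree at most \<open>d\<close>
  span. Sending \<open>e\<close>, \<open>f\<close>, \<open>H\<^sub>1\<close> to the actions of the matrix units \<open>E\<^sub>1\<^sub>2\<close>, \<open>E\<^sub>2\<^sub>1\<close>, \<open>E\<^sub>1\<^sub>1\<close> respects the relations,
  and suitable matrix entries show that the images of these monomials are linearly independent, so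
  the kernel is exactly the ideal of relations. The image is the Schur algebra: the actions
  of matrix units are the linear coefficients in \<open>t\<close> of \<open>(1 + t E)^{\<otimes>d}\<close>, hence combinations of its
  values, and conversely \<open>g^{\<otimes>d}\<close> is reached by factoring \<open>g\<close> into transvections (exponentials of \<open>e\<close>
  and \<open>f\<close>) and a diagonal matrix (a polynomial in \<open>H\<^sub>1\<close>).
\<close>

section \<open>The free algebra\<close>

text \<open>Rules such as \<open>fa.span_induct_alt\<close> produce eta-expanded functions, which the pointwise rules
  would unfold.\<close>

declare plus_fun_apply [simp del] zero_fun_apply [simp del] minus_apply [simp del]
lemmas fun_apply = plus_fun_apply zero_fun_apply minus_apply

lemma sum_apply: "(\<Sum>x\<in>A. F x) u = (\<Sum>x\<in>A. F x u)" for F :: "'a \<Rightarrow> 'b \<Rightarrow> 'c::comm_monoid_add"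
  by (induction A rule: infinite_finite_induct) (simp_all add: fun_apply)

lemma fa_ops: "fa_add p q = p + q" "fa_diff p q = p - q" "fa_zero = 0"
  by (auto simp: fa_add_def fa_diff_def fa_zero_def fun_eq_iff fun_apply)

interpretation fa: vector_space fa_smult
  by standard (auto simp: fa_smult_def fun_eq_iff fun_apply algebra_simps)

lemma fa_mult_linear:
  "fa_mult (p + q) r = fa_mult p r + fa_mult q r"
  "fa_mult r (p + q) = fa_mult r p + fa_mult r q"
  "fa_mult (p - q) r = fa_mult p r - fa_mult q r"
  "fa_mult r (p - q) = fa_mult r p - fa_mult r q"
  "fa_mult (fa_smult c p) r = fa_smult c (fa_mult p r)"
  "fa_mult r (fa_smult c p) = fa_smult c (fa_mult r p)"
  "fa_mult 0 r = 0" "fa_mult r 0 = 0"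
  by (rule ext, simp add: fun_apply fa_mult_def fa_smult_def sum.distrib sum_subtractf sum_distrib_left
      ring_distribs mult.left_commute mult.assoc)+

lemma fa_mult_mon: "fa_mult (fa_mon u) (fa_mon v) = fa_mon (u @ v)"
proof
  fix w
  have *: "fa_mon u (take i w) * fa_mon v (drop i w) =
      (if i = length u then if w = u @ v then 1 else 0 else 0)" if "i \<le> length w" for i
  proof -
    have "take i w = u \<and> drop i w = v \<longleftrightarrow> i = length u \<and> w = u @ v"
      using that by (metis append_eq_conv_conj append_take_drop_id length_take min.absorb2)
    then show ?thesis unfolding fa_mon_def by (cases "take i w = u"; cases "drop i w = v") auto
  qed
  show "fa_mult (fa_mon u) (fa_mon v) w = fa_mon (u @ v) w"
    unfolding fa_mult_def by (subst sum.cong[OF refl *]) (auto simp: fa_mon_def)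
qed

text \<open>Finite support makes \<open>p\<close> the sum of its monomials over its support. With
  the free algebra written as a span, linear identities need checking on words only.\<close>

lemma fa_carrier_span: "fa_carrier = fa.span (range fa_mon)"
proof
  show "fa_carrier \<subseteq> fa.span (range fa_mon)"
  proof
    fix p assume "p \<in> fa_carrier"
    then have fin: "finite {w. p w \<noteq> 0}" by (simp add: fa_carrier_def)
    have "p = (\<Sum>w | p w \<noteq> 0. fa_smult (p w) (fa_mon w))"
    proof
      fix u
      have "(\<Sum>w | p w \<noteq> 0. p w * fa_mon w u) = (\<Sum>w | p w \<noteq> 0. if u = w then p u else 0)"
        by (intro sum.cong) (auto simp: fa_mon_def)
      then show "p u = (\<Sum>w | p w \<noteq> 0. fa_smult (p w) (fa_mon w)) u"
        using fin by (simp add: sum_apply fa_smult_def)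
    qed
    moreover have "(\<Sum>w | p w \<noteq> 0. fa_smult (p w) (fa_mon w)) \<in> fa.span (range fa_mon)"
      by (intro fa.span_sum fa.span_scale fa.span_base) auto
    ultimately show "p \<in> fa.span (range fa_mon)" by simp
  qed
  have "fa.subspace fa_carrier"
  proof (rule fa.subspaceI)
    fix p q assume "p \<in> fa_carrier" "q \<in> fa_carrier"
    then show "p + q \<in> fa_carrier"
      unfolding fa_carrier_def
      by (auto simp: fun_apply intro: finite_subset[of _ "{w. p w \<noteq> 0} \<union> {w. q w \<noteq> 0}"])
  next
    fix c p assume "p \<in> fa_carrier"
    then show "fa_smult c p \<in> fa_carrier"
      unfolding fa_carrier_def fa_smult_def
      by (auto intro: finite_subset[of _ "{w. p w \<noteq> 0}"])
  qed (simp add: fa_carrier_def fun_apply)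
  moreover have "range fa_mon \<subseteq> fa_carrier"
    by (auto simp: fa_carrier_def fa_mon_def)
  ultimately show "fa.span (range fa_mon) \<subseteq> fa_carrier"
    by (rule fa.span_minimal[rotated])
qed

lemma fa_carrier_subspace: "fa.subspace fa_carrier"
  by (simp add: fa_carrier_span)

lemma fa_mon_carrier [simp]: "fa_mon w \<in> fa_carrier"
  by (simp add: fa_carrier_span fa.span_base)

text \<open>The step keeps \<open>q \<in> fa_carrier\<close> available because linearity of the
  representation \<open>rep\<close> is stated on the carrier.\<close>

lemma fa_carrier_induct [consumes 1, case_names zero step]:
  assumes "p \<in> fa_carrier" "P 0"
    and "\<And>c w q. q \<in> fa_carrier \<Longrightarrow> P q \<Longrightarrow> P (fa_smult c (fa_mon w) + q)"
  shows "P p"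
proof -
  have "p \<in> fa_carrier \<and> P p"
    using assms(1)[unfolded fa_carrier_span]
    by (rule fa.span_induct_alt)
       (auto intro: assms(2,3) simp: fa_carrier_subspace fa.subspace_0 fa.subspace_add fa.subspace_scale)
  then show ?thesis ..
qed

lemma fa_carrier_closed [simp]:
  "p \<in> fa_carrier \<Longrightarrow> q \<in> fa_carrier \<Longrightarrow> p + q \<in> fa_carrier"
  "p \<in> fa_carrier \<Longrightarrow> q \<in> fa_carrier \<Longrightarrow> p - q \<in> fa_carrier"
  "p \<in> fa_carrier \<Longrightarrow> fa_smult c p \<in> fa_carrier"
  "0 \<in> fa_carrier"
  by (simp_all add: fa_carrier_subspace fa.subspace_0 fa.subspace_add fa.subspace_diff
      fa.subspace_scale)

lemma fa_mult_carrier [simp]: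
  assumes "p \<in> fa_carrier" "q \<in> fa_carrier"
  shows "fa_mult p q \<in> fa_carrier"
  using assms(1)
proof (induction p rule: fa_carrier_induct)
  case zero
  then show ?case by (simp add: fa_mult_linear)
next
  case (step c w r)
  have "fa_mult (fa_mon w) q \<in> fa_carrier"
    using assms(2)
    by (induction q rule: fa_carrier_induct) (simp_all add: fa_mult_linear fa_mult_mon)
  with step show ?case by (simp add: fa_mult_linear)
qed

text \<open>Trilinearity reduces the claim to three words, where it is associativity of
  concatenation.\<close>

lemma fa_mult_assoc:
  assumes "p \<in> fa_carrier" "q \<in> fa_carrier" "r \<in> fa_carrier"
  shows "fa_mult (fa_mult p q) r = fa_mult p (fa_mult q r)"
  using assms(1)
proof (induction p rule: fa_carrier_induct)
  case zero
  then show ?case by (simp add: fa_mult_linear)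
next
  case (step c u p)
  have "fa_mult (fa_mult (fa_mon u) q) r = fa_mult (fa_mon u) (fa_mult q r)"
    using assms(2)
  proof (induction q rule: fa_carrier_induct)
    case zero
    then show ?case by (simp add: fa_mult_linear)
  next
    case (step c v q)
    have "fa_mult (fa_mon (u @ v)) r = fa_mult (fa_mon u) (fa_mult (fa_mon v) r)"
      using assms(3)
      by (induction r rule: fa_carrier_induct) (simp_all add: fa_mult_linear fa_mult_mon)
    with step show ?case by (simp add: fa_mult_linear fa_mult_mon)
  qed
  with step show ?case by (simp add: fa_mult_linear)
qed

lemma fa_one_carrier [simp]: "fa_one \<in> fa_carrier" "fa_gen x \<in> fa_carrier"
  by (simp_all add: fa_one_def fa_gen_def)

lemma hprod_carrier [simp]: "hprod n \<in> fa_carrier"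
  by (induction n) (simp_all add: fa_ops)

lemma rels_carrier: "rels d \<subseteq> fa_carrier"
  by (auto simp: rels_def rel1_def rel2_def rel3_def fa_ops)

section \<open>Spanning\<close>

lemma fa_ideal_subspace: "fa.subspace (fa_ideal R)"
  by (rule fa.subspaceI) (metis fa_ops fa_ideal.intros)+

lemma fa_ideal_mult_left:
  assumes "R \<subseteq> fa_carrier" "p \<in> fa_ideal R"
  shows "fa_mult (fa_mon u) p \<in> fa_ideal R"
  using assms(2)
proof induction
  case (gen r v w)
  have "fa_mult (fa_mon u) (fa_mult (fa_mon v) (fa_mult r (fa_mon w)))
      = fa_mult (fa_mon (u @ v)) (fa_mult r (fa_mon w))"
    using gen assms(1) by (auto simp flip: fa_mult_assoc fa_mult_mon)
  with gen show ?case by (simp add: fa_ideal.gen)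
qed (simp_all add: fa_mult_linear fa_ops fa.subspace_0 fa.subspace_add fa.subspace_scale
    fa_ideal_subspace)

lemma fa_ideal_mult_right:
  assumes "R \<subseteq> fa_carrier" "p \<in> fa_ideal R"
  shows "fa_mult p (fa_mon u) \<in> fa_ideal R"
  using assms(2)
proof induction
  case (gen r v w)
  have "fa_mult (fa_mult (fa_mon v) (fa_mult r (fa_mon w))) (fa_mon u)
      = fa_mult (fa_mon v) (fa_mult r (fa_mon (w @ u)))"
    using gen assms(1) by (auto simp: fa_mult_assoc simp flip: fa_mult_mon)
  with gen show ?case by (simp add: fa_ideal.gen)
qed (simp_all add: fa_mult_linear fa_ops fa.subspace_0 fa.subspace_add fa.subspace_scale
    fa_ideal_subspace)

lemma fa_ideal_carrier:
  assumes "R \<subseteq> fa_carrier"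
  shows "fa_ideal R \<subseteq> fa_carrier"
proof
  fix p assume "p \<in> fa_ideal R"
  then show "p \<in> fa_carrier"
    by induction (use assms in \<open>auto simp: fa_ops\<close>)
qed

text \<open>The first three relations as rewriting rules inside arbitrary contexts \<open>u\<close>
  and \<open>v\<close>, the form in which every reordering of words uses them.\<close>

lemma rels_ideal:
  "fa_mon (u @ Gh # Ge # v) - fa_mon (u @ Ge # Gh # v) - fa_mon (u @ Ge # v) \<in> fa_ideal (rels d)"
  "fa_mon (u @ Ge # Gf # v) - fa_mon (u @ Gf # Ge # v)
    - (fa_smult 2 (fa_mon (u @ Gh # v)) - fa_smult (of_nat d) (fa_mon (u @ v))) \<in> fa_ideal (rels d)"
  "fa_mon (u @ Gh # Gf # v) - fa_mon (u @ Gf # Gh # v) + fa_mon (u @ Gf # v) \<in> fa_ideal (rels d)"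
  using fa_ideal.gen[of rel1 "rels d" u v] fa_ideal.gen[of "rel2 d" "rels d" u v]
    fa_ideal.gen[of rel3 "rels d" u v]
  by (simp_all add: rels_def rel1_def rel2_def rel3_def fa_ops fa_gen_def fa_one_def fa_mult_linear
      fa_mult_mon)

text \<open>The bound is strict: for a word \<open>w\<close>, \<open>filt d (length w)\<close> holds
  the terms of lower degree modulo the ideal, and \<open>filt d 0\<close> is the ideal
  itself.\<close>

definition filt :: "nat \<Rightarrow> nat \<Rightarrow> fa set" where
  "filt d n = fa.span (fa_ideal (rels d) \<union> fa_mon ` {w. length w < n})"

lemma filt_mon: "length w < n \<Longrightarrow> fa_mon w \<in> filt d n"
  unfolding filt_def by (intro fa.span_base) auto

lemma filt_ideal: "p \<in> fa_ideal (rels d) \<Longrightarrow> p \<in> filt d n"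
  unfolding filt_def by (intro fa.span_base) auto

lemma filt_closed:
  "0 \<in> filt d n"
  "p \<in> filt d n \<Longrightarrow> q \<in> filt d n \<Longrightarrow> p + q \<in> filt d n"
  "p \<in> filt d n \<Longrightarrow> q \<in> filt d n \<Longrightarrow> p - q \<in> filt d n"
  "p \<in> filt d n \<Longrightarrow> - p \<in> filt d n"
  "p \<in> filt d n \<Longrightarrow> fa_smult c p \<in> filt d n"
  unfolding filt_def
  by (simp_all add: fa.span_zero fa.span_add fa.span_diff fa.span_neg fa.span_scale)

lemma filt_mono: "m \<le> n \<Longrightarrow> p \<in> filt d m \<Longrightarrow> p \<in> filt d n"
  unfolding filt_def by (rule subsetD[OF fa.span_mono]) auto

lemma filt_least:
  assumes "p \<in> filt d n" "fa.subspace S" "fa_ideal (rels d) \<subseteq> S"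
    and "\<And>w. length w < n \<Longrightarrow> fa_mon w \<in> S"
  shows "p \<in> S"
  using assms fa.span_minimal[of "fa_ideal (rels d) \<union> fa_mon ` {w. length w < n}" S]
  unfolding filt_def by auto

lemma filt_mult_left:
  assumes "p \<in> filt d n"
  shows "fa_mult (fa_mon u) p \<in> filt d (length u + n)"
proof -
  let ?S = "{p. fa_mult (fa_mon u) p \<in> filt d (length u + n)}"
  have "fa.subspace ?S"
    by (rule fa.subspaceI) (auto simp: fa_mult_linear filt_closed)
  moreover have "fa_ideal (rels d) \<subseteq> ?S"
    using fa_ideal_mult_left[OF rels_carrier] by (auto intro: filt_ideal)
  ultimately have "p \<in> ?S"
    using assms by (rule_tac filt_least) (auto simp: fa_mult_mon intro: filt_mon)
  then show ?thesis by simp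
qed

text \<open>Each of the first three relations exchanges two letters up to strictly shorter words, so
  the associated graded algebra is commutative.\<close>

lemma mon_swap:
  "fa_mon (u @ x # y # v) - fa_mon (u @ y # x # v) \<in> filt d (length u + length v + 2)"
proof -
  let ?n = "length u + length v + 2"
  have low: "fa_mon (u @ z # v) \<in> filt d ?n" "fa_mon (u @ v) \<in> filt d ?n" for z
    by (auto intro: filt_mon)
  have 1: "fa_mon (u @ Gh # Ge # v) - fa_mon (u @ Ge # Gh # v) \<in> filt d ?n"
    using filt_closed(2)[OF filt_ideal[OF rels_ideal(1)[of u v d]] low(1)[of Ge]] by simp
  have 2: "fa_mon (u @ Ge # Gf # v) - fa_mon (u @ Gf # Ge # v) \<in> filt d ?n"
    using filt_closed(2)[OF filt_ideal[OF rels_ideal(2)[of u v d]]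
        filt_closed(3)[OF filt_closed(5)[OF low(1)[of Gh], of 2]
            filt_closed(5)[OF low(2), of "of_nat d"]]] by simp
  have 3: "fa_mon (u @ Gh # Gf # v) - fa_mon (u @ Gf # Gh # v) \<in> filt d ?n"
    using filt_closed(3)[OF filt_ideal[OF rels_ideal(3)[of u v d]] low(1)[of Gf]] by simp
  show ?thesis
    using 1 2 3 filt_closed(4)[OF 1] filt_closed(4)[OF 2] filt_closed(4)[OF 3]
    by (cases x; cases y) (auto simp: filt_closed(1))
qed

lemma filt_trans:
  "p - q \<in> filt d n \<Longrightarrow> q - r \<in> filt d n \<Longrightarrow> p - r \<in> filt d n"
  using filt_closed(2)[of "p - q" d n "q - r"] by simp

lemma mon_move:
  "fa_mon (u @ x # w @ v) - fa_mon (u @ w @ x # v)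
    \<in> filt d (length u + length w + length v + 1)"
proof (induction w arbitrary: u)
  case Nil
  then show ?case by (simp add: filt_closed)
next
  case (Cons y w)
  let ?n = "length u + length w + length v + 2"
  have "fa_mon (u @ x # y # w @ v) - fa_mon (u @ y # x # w @ v) \<in> filt d ?n"
    using mon_swap[of u x y "w @ v" d] by (simp add: add.assoc)
  moreover have "fa_mon (u @ y # x # w @ v) - fa_mon (u @ y # w @ x # v) \<in> filt d ?n"
    using Cons[of "u @ [y]"] by simp
  ultimately show ?case using filt_trans by fastforce
qed

lemma count_list_gen: "count_list w Ge + count_list w Gh + count_list w Gf = length w"
  by (induction w) (auto, metis gen.exhaust)

text \<open>The tail is sorted by induction; the new first letter then moves past the blocks that
  must precede it.\<close>

lemma mon_sort:
  "fa_mon w - pbw_mon (count_list w Ge) (count_list w Gh) (count_list w Gf) \<in> filt d (length w)"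
proof (induction w)
  case Nil
  then show ?case by (simp add: pbw_mon_def filt_closed)
next
  case (Cons x w)
  define a b c where "a = count_list w Ge" and "b = count_list w Gh" and "c = count_list w Gf"
  have len: "length w = a + b + c"
    by (simp add: a_def b_def c_def count_list_gen)
  have "fa_mon (x # w) - fa_mon (x # replicate a Ge @ replicate b Gh @ replicate c Gf)
      \<in> filt d (length (x # w))"
    using filt_mult_left[OF Cons, of "[x]"]
    by (simp add: fa_mult_linear fa_mult_mon pbw_mon_def a_def b_def c_def)
  moreover have "fa_mon (x # replicate a Ge @ replicate b Gh @ replicate c Gf)
      - pbw_mon (count_list (x # w) Ge) (count_list (x # w) Gh) (count_list (x # w) Gf)
      \<in> filt d (length (x # w))"
  proof (cases x)
    case Ge
    then show ?thesis by (simp add: pbw_mon_def a_def b_def c_def filt_closed)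
  next
    case Gh
    then show ?thesis
      using mon_move[of "[]" Gh "replicate a Ge" "replicate b Gh @ replicate c Gf" d] len
      by (simp add: pbw_mon_def ac_simps flip: a_def b_def c_def)
  next
    case Gf
    then show ?thesis
      using mon_move[of "[]" Gf "replicate a Ge @ replicate b Gh" "replicate c Gf" d] len
      by (simp add: pbw_mon_def ac_simps flip: a_def b_def c_def)
  qed
  ultimately show ?case by (rule filt_trans)
qed

text \<open>Moving \<open>x\<close> through a word of length \<open>m\<close> costs only words of
  length at most \<open>m\<close>, although both products have length \<open>m + 1\<close>.\<close>

lemma filt_commutator:
  assumes "p \<in> filt d n"
  shows "fa_mult (fa_mon [x]) p - fa_mult p (fa_mon [x]) \<in> filt d n"
proof -
  let ?S = "{p. fa_mult (fa_mon [x]) p - fa_mult p (fa_mon [x]) \<in> filt d n}"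
  have "fa.subspace ?S"
  proof (rule fa.subspaceI)
    fix p q assume "p \<in> ?S" "q \<in> ?S"
    then have "(fa_mult (fa_mon [x]) p - fa_mult p (fa_mon [x]))
        + (fa_mult (fa_mon [x]) q - fa_mult q (fa_mon [x])) \<in> filt d n"
      by (simp add: filt_closed)
    then show "p + q \<in> ?S"
      by (simp add: fa_mult_linear algebra_simps)
  qed (auto simp: fa_mult_linear filt_closed simp flip: fa.scale_right_diff_distrib)
  moreover have "fa_ideal (rels d) \<subseteq> ?S"
    using fa_ideal_mult_left[OF rels_carrier] fa_ideal_mult_right[OF rels_carrier]
    by (auto intro!: filt_closed(3) intro: filt_ideal)
  ultimately have "p \<in> ?S"
    using assms
  proof (rule_tac filt_least)
    fix w :: "gen list" assume "length w < n"
    then have "fa_mon (x # w) - fa_mon (w @ [x]) \<in> filt d n"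
      using mon_move[of "[]" x w "[]" d] by (auto intro: filt_mono[of "Suc (length w)" n])
    then show "fa_mon w \<in> ?S"
      by (simp add: fa_mult_mon)
  qed auto
  then show ?thesis by simp
qed

text \<open>One order finer than \<open>mon_move\<close>: the correction is one letter shorter than
  the words compared, and only still shorter words are discarded. Each of the \<open>b\<close>
  letters contributes one copy of \<open>[x, h] = s x\<close>. For \<open>b = 0\<close> the
  truncated \<open>b - 1\<close> comes with coefficient zero.\<close>

lemma commute_past_Gh:
  fixes s :: rat
  assumes rel: "\<And>u v. fa_mon (u @ x # Gh # v) - fa_mon (u @ Gh # x # v)
      - fa_smult s (fa_mon (u @ x # v)) \<in> fa_ideal (rels d)"
  shows "fa_mon (u @ x # replicate b Gh @ v) - fa_mon (u @ replicate b Gh @ x # v)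
      - fa_smult (s * of_nat b) (fa_mon (u @ x # replicate (b - 1) Gh @ v))
    \<in> filt d (length u + b + length v)"
proof (induction b arbitrary: u)
  case 0
  then show ?case by (simp add: filt_closed)
next
  case (Suc b)
  let ?n = "length u + Suc b + length v"
  let ?r = "\<lambda>b. replicate b Gh"
  have A: "fa_mon (u @ x # Gh # ?r b @ v) - fa_mon (u @ Gh # x # ?r b @ v)
      - fa_smult s (fa_mon (u @ x # ?r b @ v)) \<in> filt d ?n"
    by (intro filt_ideal rel)
  have B: "fa_mon (u @ Gh # x # ?r b @ v) - fa_mon (u @ Gh # ?r b @ x # v)
      - fa_smult (s * of_nat b) (fa_mon (u @ Gh # x # ?r (b - 1) @ v)) \<in> filt d ?n"
    using Suc[of "u @ [Gh]"] by simp
  \<comment> \<open>The inductive correction has \<open>x\<close> behind a \<open>Gh\<close>.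
    Swapping the two merges it with the correction in \<open>A\<close> and raises the factor from
    \<open>b\<close> to \<open>b + 1\<close>.\<close>
  have C: "fa_smult (s * of_nat b)
      (fa_mon (u @ Gh # x # ?r (b - 1) @ v) - fa_mon (u @ x # ?r b @ v)) \<in> filt d ?n"
  proof (cases b)
    case 0
    then show ?thesis by (simp add: filt_closed)
  next
    case (Suc b')
    then show ?thesis
      using mon_swap[of u Gh x "?r b' @ v" d] by (auto intro!: filt_closed(5) simp: ac_simps)
  qed
  have eq: "fa_mon (u @ x # ?r (Suc b) @ v) - fa_mon (u @ ?r (Suc b) @ x # v)
      - fa_smult (s * of_nat (Suc b)) (fa_mon (u @ x # ?r (Suc b - 1) @ v))
    = (fa_mon (u @ x # Gh # ?r b @ v) - fa_mon (u @ Gh # x # ?r b @ v)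
      - fa_smult s (fa_mon (u @ x # ?r b @ v)))
    + (fa_mon (u @ Gh # x # ?r b @ v) - fa_mon (u @ Gh # ?r b @ x # v)
      - fa_smult (s * of_nat b) (fa_mon (u @ Gh # x # ?r (b - 1) @ v)))
    + fa_smult (s * of_nat b)
      (fa_mon (u @ Gh # x # ?r (b - 1) @ v) - fa_mon (u @ x # ?r b @ v))"
    by (rule ext) (simp add: fa_smult_def fun_apply algebra_simps)
  show ?case unfolding eq by (intro filt_closed(2) A B C)
qed

lemma commute_Ge_Gh:
  "fa_mon (u @ Ge # replicate b Gh @ v) - fa_mon (u @ replicate b Gh @ Ge # v)
      - fa_smult (- of_nat b) (fa_mon (u @ Ge # replicate (b - 1) Gh @ v))
    \<in> filt d (length u + b + length v)"
proof -
  have "fa_mon (u @ Ge # Gh # v) - fa_mon (u @ Gh # Ge # v) - fa_smult (- 1) (fa_mon (u @ Ge # v))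
      \<in> fa_ideal (rels d)" for u v
    using fa.subspace_neg[OF fa_ideal_subspace rels_ideal(1)[of u v d]]
    by (simp add: algebra_simps)
  from commute_past_Gh[OF this] show ?thesis by simp
qed

lemma commute_Gf_Gh:
  "fa_mon (u @ Gf # replicate b Gh @ v) - fa_mon (u @ replicate b Gh @ Gf # v)
      - fa_smult (of_nat b) (fa_mon (u @ Gf # replicate (b - 1) Gh @ v))
    \<in> filt d (length u + b + length v)"
proof -
  have "fa_mon (u @ Gf # Gh # v) - fa_mon (u @ Gh # Gf # v) - fa_smult 1 (fa_mon (u @ Gf # v))
      \<in> fa_ideal (rels d)" for u v
    using fa.subspace_neg[OF fa_ideal_subspace rels_ideal(3)[of u v d]]
    by (simp add: algebra_simps)
  from commute_past_Gh[OF this] show ?thesis by simp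
qed

text \<open>To the same order, \<open>[f, e^a]\<close> is \<open>-2a e^(a-1) h\<close>: each
  \<open>e\<close> yields \<open>-2h\<close>, and the scalar \<open>d\<close> of the relation gives
  words two letters shorter, which are absorbed.\<close>

lemma commute_Gf_Ge:
  "fa_mon (u @ Gf # replicate a Ge @ v) - fa_mon (u @ replicate a Ge @ Gf # v)
      + fa_smult (2 * of_nat a) (fa_mon (u @ replicate (a - 1) Ge @ Gh # v))
    \<in> filt d (length u + a + length v)"
proof (induction a arbitrary: u)
  case 0
  then show ?case by (simp add: filt_closed)
next
  case (Suc a)
  let ?n = "length u + Suc a + length v"
  let ?r = "\<lambda>a. replicate a Ge"
  have A: "fa_mon (u @ Ge # Gf # ?r a @ v) - fa_mon (u @ Gf # Ge # ?r a @ v)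
      - (fa_smult 2 (fa_mon (u @ Gh # ?r a @ v)) - fa_smult (of_nat d) (fa_mon (u @ ?r a @ v)))
      \<in> filt d ?n"
    by (intro filt_ideal rels_ideal)
  have B: "fa_mon (u @ Ge # Gf # ?r a @ v) - fa_mon (u @ Ge # ?r a @ Gf # v)
      + fa_smult (2 * of_nat a) (fa_mon (u @ Ge # ?r (a - 1) @ Gh # v)) \<in> filt d ?n"
    using Suc[of "u @ [Ge]"] by simp
  have C: "fa_mon (u @ Gh # ?r a @ v) - fa_mon (u @ ?r a @ Gh # v) \<in> filt d ?n"
    using mon_move[of u Gh "?r a" v d] by (simp add: ac_simps)
  have D: "fa_mon (u @ ?r a @ v) \<in> filt d ?n"
    by (rule filt_mon) simp
  have eq: "fa_mon (u @ Gf # ?r (Suc a) @ v) - fa_mon (u @ ?r (Suc a) @ Gf # v)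
      + fa_smult (2 * of_nat (Suc a)) (fa_mon (u @ ?r (Suc a - 1) @ Gh # v))
    = (fa_mon (u @ Ge # Gf # ?r a @ v) - fa_mon (u @ Ge # ?r a @ Gf # v)
      + fa_smult (2 * of_nat a) (fa_mon (u @ Ge # ?r (a - 1) @ Gh # v)))
    - (fa_mon (u @ Ge # Gf # ?r a @ v) - fa_mon (u @ Gf # Ge # ?r a @ v)
      - (fa_smult 2 (fa_mon (u @ Gh # ?r a @ v)) - fa_smult (of_nat d) (fa_mon (u @ ?r a @ v))))
    - fa_smult 2 (fa_mon (u @ Gh # ?r a @ v) - fa_mon (u @ ?r a @ Gh # v))
    + fa_smult (of_nat d) (fa_mon (u @ ?r a @ v))"
    by (cases a) (simp_all add: fun_eq_iff fa_smult_def fun_apply algebra_simps)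
  show ?case
    unfolding eq by (intro filt_closed A B C D)
qed

text \<open>The product is monic of degree \<open>n + 1\<close> in \<open>Gh\<close>. The remainder
  is placed in a span of words alone, which keeps it in the carrier during the induction.\<close>

lemma hprod_leading:
  "hprod n - fa_mon (replicate (Suc n) Gh) \<in> fa.span (fa_mon ` {w. length w < Suc n})"
proof (induction n)
  case 0
  then show ?case by (simp add: fa_gen_def fa.span_zero)
next
  case (Suc n)
  let ?V = "\<lambda>n. fa.span (fa_mon ` {w. length w < n})"
  define q where "q = hprod n - fa_mon (replicate (Suc n) Gh)"
  have hp: "hprod n = fa_mon (replicate (Suc n) Gh) + q" by (simp add: q_def)
  have mono: "p \<in> ?V (Suc n) \<Longrightarrow> p \<in> ?V (Suc (Suc n))" for p
    by (rule subsetD[OF fa.span_mono]) auto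
  have q: "q \<in> ?V (Suc n)" using Suc by (simp add: q_def)
  have qh: "fa_mult q (fa_mon [Gh]) \<in> ?V (Suc (Suc n))"
    using q
  proof (induction q rule: fa.span_induct_alt)
    case base
    then show ?case by (simp add: fa_mult_linear fa.span_zero)
  next
    case (step c x y)
    then obtain w where w: "x = fa_mon w" "length w < Suc n" by auto
    then have "fa_mon (w @ [Gh]) \<in> ?V (Suc (Suc n))" by (intro fa.span_base) auto
    with step w show ?case
      by (simp add: fa_mult_linear fa_mult_mon fa.span_add fa.span_scale)
  qed
  have h: "fa_mon (replicate (Suc n) Gh) \<in> ?V (Suc (Suc n))"
    by (intro fa.span_base) auto
  have q1: "fa_mult q (fa_mon []) = q"
  proof -
    have "?V (Suc n) \<subseteq> fa_carrier"
      unfolding fa_carrier_span by (intro fa.span_mono) auto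
    with q have "q \<in> fa_carrier" by auto
    then show ?thesis
      by (induction q rule: fa_carrier_induct) (simp_all add: fa_mult_linear fa_mult_mon)
  qed
  have "hprod (Suc n) - fa_mon (replicate (Suc (Suc n)) Gh)
      = fa_mult q (fa_mon [Gh]) - fa_smult (of_nat (Suc n)) (fa_mon (replicate (Suc n) Gh) + q)"
    by (simp add: hp fa_ops fa_gen_def fa_one_def fa_mult_linear fa_mult_mon q1
        replicate_append_same algebra_simps del: replicate.simps of_nat_Suc)
      (simp add: fa.scale_right_distrib del: of_nat_Suc)
  moreover have "\<dots> \<in> ?V (Suc (Suc n))"
    by (intro fa.span_diff fa.span_scale fa.span_add qh h mono q)
  ultimately show ?case by simp
qed

text \<open>Commuting the relation for \<open>h^(d+1)\<close> with \<open>e\<close> and then with \<open>f\<close> produces every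
  monomial of degree \<open>d + 1\<close>.\<close>

lemma pbw_top:
  assumes "a + b + c = Suc d"
  shows "pbw_mon a b c \<in> filt d (Suc d)"
  using assms
proof (induction c arbitrary: a b)
  case 0
  then show ?case
  proof (induction a arbitrary: b)
    case 0
    have "hprod d \<in> fa_ideal (rels d)"
    proof -
      have "fa_mult (fa_mon []) (fa_mult (hprod d) (fa_mon [])) = hprod d"
      proof -
        have "fa_mult (fa_mon []) p = p \<and> fa_mult p (fa_mon []) = p" if "p \<in> fa_carrier" for p
          using that
          by (induction p rule: fa_carrier_induct) (simp_all add: fa_mult_linear fa_mult_mon)
        then show ?thesis by simp
      qed
      then show ?thesis using fa_ideal.gen[of "hprod d" "rels d" "[]" "[]"]
        by (simp add: rels_def)
    qed
    moreover have "hprod d - fa_mon (replicate (Suc d) Gh) \<in> filt d (Suc d)"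
      unfolding filt_def by (rule subsetD[OF fa.span_mono hprod_leading]) auto
    ultimately have "fa_mon (replicate (Suc d) Gh) \<in> filt d (Suc d)"
      using filt_closed(3)[OF filt_ideal[of "hprod d" d "Suc d"]] by fastforce
    with 0 show ?case by (simp add: pbw_mon_def del: replicate_Suc)
  next
    case (Suc a)
    \<comment> \<open>One \<open>h\<close> is traded for an \<open>e\<close>: the commutator of
      \<open>e\<close> with this monomial stays in the filtration, and its leading term is
      \<open>-(b+1) e^(a+1) h^b\<close>, whose factor is invertible over the rationals.\<close>
    let ?p = "pbw_mon a (Suc b) 0"
    have "?p \<in> filt d (Suc d)" using Suc by simp
    from filt_commutator[OF this, of Ge]
    have A: "fa_mon (Ge # replicate a Ge @ replicate (Suc b) Gh)
        - fa_mon (replicate a Ge @ replicate (Suc b) Gh @ [Ge]) \<in> filt d (Suc d)"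
      by (simp add: pbw_mon_def fa_mult_mon)
    have B: "fa_mon (Ge # replicate a Ge @ replicate (Suc b) Gh)
        - fa_mon (replicate a Ge @ replicate (Suc b) Gh @ [Ge])
        - fa_smult (- of_nat (Suc b)) (fa_mon (Ge # replicate a Ge @ replicate b Gh))
        \<in> filt d (Suc d)"
      using commute_Ge_Gh[of "replicate a Ge" "Suc b" "[]" d] Suc.prems
      by (simp add: replicate_app_Cons_same del: of_nat_Suc)
    from filt_closed(5)[OF filt_closed(3)[OF A B], of "- 1 / of_nat (Suc b)"]
    show ?case by (simp add: pbw_mon_def del: of_nat_Suc)
  qed
next
  case (Suc c)
  let ?G = "filt d (Suc d)" and ?E = "\<lambda>a. replicate a Ge" and ?H = "\<lambda>b. replicate b Gh"
    and ?F = "\<lambda>c. replicate c Gf"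
  \<comment> \<open>The commutator with \<open>f\<close> has two leading terms, from passing
    \<open>e^a\<close> and from passing \<open>h^(b+1)\<close>; the second one is wanted.\<close>
  have "pbw_mon a (Suc b) c \<in> ?G" using Suc by simp
  from filt_commutator[OF this, of Gf]
  have A: "fa_mon (Gf # ?E a @ ?H (Suc b) @ ?F c) - fa_mon (?E a @ ?H (Suc b) @ Gf # ?F c) \<in> ?G"
    by (simp add: pbw_mon_def fa_mult_mon replicate_append_same)
  have B: "fa_mon (Gf # ?E a @ ?H (Suc b) @ ?F c) - fa_mon (?E a @ Gf # ?H (Suc b) @ ?F c)
      + fa_smult (2 * of_nat a) (fa_mon (?E (a - 1) @ Gh # ?H (Suc b) @ ?F c)) \<in> ?G"
    using commute_Gf_Ge[of "[]" a "?H (Suc b) @ ?F c" d] Suc.prems by (simp add: add.assoc)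
  have C: "fa_mon (?E a @ Gf # ?H (Suc b) @ ?F c) - fa_mon (?E a @ ?H (Suc b) @ Gf # ?F c)
      - fa_smult (of_nat (Suc b)) (fa_mon (?E a @ Gf # ?H b @ ?F c)) \<in> ?G"
    using commute_Gf_Gh[of "?E a" "Suc b" "?F c" d] Suc.prems by (simp del: of_nat_Suc)
  \<comment> \<open>The unwanted term \<open>e^(a-1) h^(b+2) f^c\<close> again has degree
    \<open>d + 1\<close> and the same \<open>c\<close>, so the induction hypothesis covers
    it.\<close>
  have D: "fa_smult (2 * of_nat a) (fa_mon (?E (a - 1) @ Gh # ?H (Suc b) @ ?F c)) \<in> ?G"
  proof (cases a)
    case 0
    then show ?thesis by (simp add: filt_closed)
  next
    case (Suc a')
    then have "pbw_mon a' (Suc (Suc b)) c \<in> ?G" using Suc.IH Suc.prems by simp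
    with Suc show ?thesis by (auto simp: pbw_mon_def intro: filt_closed(5))
  qed
  have "fa_smult (of_nat (Suc b)) (fa_mon (?E a @ Gf # ?H b @ ?F c)) \<in> ?G"
    using filt_closed(3)[OF filt_closed(2)[OF filt_closed(3)[OF A B] D] C]
    by (simp add: algebra_simps del: of_nat_Suc)
  from filt_closed(5)[OF this, of "1 / of_nat (Suc b)"]
  have E: "fa_mon (?E a @ Gf # ?H b @ ?F c) \<in> ?G" by (simp del: of_nat_Suc)
  have "fa_mon (?E a @ Gf # ?H b @ ?F c) - fa_mon (?E a @ ?H b @ Gf # ?F c) \<in> ?G"
    using mon_move[of "?E a" Gf "?H b" "?F c" d] Suc.prems by simp
  from filt_closed(3)[OF E this] show ?case by (simp add: pbw_mon_def)
qed

text \<open>Prepending a letter to words of length at most \<open>d\<close> reaches length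
  \<open>d + 1\<close> at worst, and sorting followed by \<open>pbw_top\<close> brings such words
  back down.\<close>

lemma mon_filt: "fa_mon w \<in> filt d (Suc d)"
proof (induction w)
  case Nil
  then show ?case by (simp add: filt_mon)
next
  case (Cons x w)
  from filt_mult_left[OF this, of "[x]"] have "fa_mon (x # w) \<in> filt d (Suc (Suc d))"
    by (simp add: fa_mult_mon)
  moreover have "fa.subspace (filt d (Suc d))"
    unfolding filt_def by (rule fa.subspace_span)
  moreover have "fa_mon v \<in> filt d (Suc d)" if "length v < Suc (Suc d)" for v
  proof (cases "length v = Suc d")
    case True
    then have "pbw_mon (count_list v Ge) (count_list v Gh) (count_list v Gf) \<in> filt d (Suc d)"
      by (intro pbw_top) (simp add: count_list_gen)
    with mon_sort[of v d] True filt_closed(2) show ?thesis by fastforce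
  qed (use that in \<open>auto intro: filt_mon\<close>)
  ultimately show ?case
    by (auto intro: filt_least filt_ideal)
qed

text \<open>The pointwise form matches the combinations in the final statement, which can then be
  folded.\<close>

definition pbw_comb :: "nat \<Rightarrow> (nat \<times> nat \<times> nat \<Rightarrow> rat) \<Rightarrow> fa" where
  "pbw_comb d c = (\<lambda>w. \<Sum>(a,b,k)\<in>{(a,b,k). a + b + k \<le> d}. c (a,b,k) * pbw_mon a b k w)"

lemma finite_pbw_index: "finite {(a::nat,b,k). a + b + k \<le> d}"
  by (rule finite_subset[of _ "{..d} \<times> {..d} \<times> {..d}"]) auto

lemma pbw_comb_linear:
  "pbw_comb d (\<lambda>x. c x + c' x) = pbw_comb d c + pbw_comb d c'"
  "pbw_comb d (\<lambda>x. s * c x) = fa_smult s (pbw_comb d c)"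
  "pbw_comb d (\<lambda>_. 0) = 0"
  by (auto simp: pbw_comb_def fun_eq_iff fun_apply fa_smult_def split_beta sum.distrib
      sum_distrib_left algebra_simps)

lemma pbw_comb_single:
  assumes "a + b + k \<le> d"
  shows "pbw_comb d (\<lambda>x. if x = (a,b,k) then 1 else 0) = pbw_mon a b k"
proof
  fix w
  have "(\<Sum>x\<in>{(a,b,k). a + b + k \<le> d}.
      case x of (a',b',k') \<Rightarrow> (if (a',b',k') = (a,b,k) then 1 else 0) * pbw_mon a' b' k' w)
    = (\<Sum>x\<in>{(a,b,k). a + b + k \<le> d}. if x = (a,b,k) then pbw_mon a b k w else 0)"
    by (intro sum.cong) (auto split: if_splits)
  also have "\<dots> = pbw_mon a b k w"
    using assms by (simp add: finite_pbw_index)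
  finally show "pbw_comb d (\<lambda>x. if x = (a,b,k) then 1 else 0) w = pbw_mon a b k w"
    by (simp add: pbw_comb_def)
qed

theorem pbw_spanning:
  assumes "p \<in> fa_carrier"
  shows "\<exists>c. p - pbw_comb d c \<in> fa_ideal (rels d)"
proof -
  define S where "S = {p. \<exists>c. p - pbw_comb d c \<in> fa_ideal (rels d)}"
  have sub: "fa.subspace S"
  proof (rule fa.subspaceI)
    show "0 \<in> S"
      unfolding S_def using pbw_comb_linear(3)[of d] fa.subspace_0[OF fa_ideal_subspace]
      by (auto intro!: exI[of _ "\<lambda>_. 0"])
  next
    fix p q assume "p \<in> S" "q \<in> S"
    then obtain c c' where "p - pbw_comb d c \<in> fa_ideal (rels d)"
      "q - pbw_comb d c' \<in> fa_ideal (rels d)" unfolding S_def by blast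
    from fa.subspace_add[OF fa_ideal_subspace this]
    have "p + q - pbw_comb d (\<lambda>x. c x + c' x) \<in> fa_ideal (rels d)"
      by (simp add: pbw_comb_linear algebra_simps)
    then show "p + q \<in> S" unfolding S_def by blast
  next
    fix s p assume "p \<in> S"
    then obtain c where "p - pbw_comb d c \<in> fa_ideal (rels d)" unfolding S_def by blast
    from fa.subspace_scale[OF fa_ideal_subspace this, of s]
    have "fa_smult s p - pbw_comb d (\<lambda>x. s * c x) \<in> fa_ideal (rels d)"
      by (simp add: pbw_comb_linear fa.scale_right_diff_distrib)
    then show "fa_smult s p \<in> S" unfolding S_def by blast
  qed
  have ideal: "fa_ideal (rels d) \<subseteq> S"
    unfolding S_def using pbw_comb_linear(3)[of d] by (auto intro!: exI[of _ "\<lambda>_. 0"])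
  have pbw: "pbw_mon a b k \<in> S" if "a + b + k \<le> d" for a b k
    unfolding S_def using pbw_comb_single[OF that] fa.subspace_0[OF fa_ideal_subspace]
    by (auto intro!: exI[of _ "\<lambda>x. if x = (a,b,k) then 1 else 0"])
  \<comment> \<open>Sorting a word of length \<open>n\<close> leaves a remainder in
    \<open>filt d n\<close>, covered by the induction hypothesis. The bound on \<open>n\<close>
    ensures that the sorted monomial has degree at most \<open>d\<close>.\<close>
  have "n \<le> Suc d \<Longrightarrow> filt d n \<subseteq> S" for n
  proof (induction n)
    case 0
    then show ?case using filt_least[OF _ sub ideal, of _ 0] by auto
  next
    case (Suc n)
    have "fa_mon w \<in> S" if "length w < Suc n" for w
    proof (cases "length w = n")
      case True
      have "pbw_mon (count_list w Ge) (count_list w Gh) (count_list w Gf) \<in> S"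
        using True Suc.prems by (intro pbw) (simp add: count_list_gen)
      moreover have "fa_mon w - pbw_mon (count_list w Ge) (count_list w Gh) (count_list w Gf) \<in> S"
        using mon_sort[of w d] True Suc by auto
      ultimately show ?thesis using fa.subspace_add[OF sub] by fastforce
    next
      case False
      with that have "fa_mon w \<in> filt d n" by (intro filt_mon) simp
      with Suc show ?thesis by auto
    qed
    then show ?case using filt_least[OF _ sub ideal] by blast
  qed
  then have "fa_mon w \<in> S" for w using mon_filt[of w d] by blast
  then have "fa.span (range fa_mon) \<subseteq> S" by (intro fa.span_minimal sub) auto
  with assms show ?thesis by (auto simp: S_def fa_carrier_span)
qed

section \<open>Action on the tensor power\<close>

definition mscale :: "rat \<Rightarrow> mat \<Rightarrow> mat" where
  "mscale c M = (\<lambda>i j. c * M i j)"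

interpretation mat: vector_space mscale
  by standard (auto simp: mscale_def fun_eq_iff fun_apply algebra_simps)

section \<open>Matrices on the tensor power and induction on the first tensor factor\<close>

lemma tidx_0 [simp]: "tidx 0 = {[]}"
  by (auto simp: tidx_def)

lemma Cons_in_tidx [simp]: "a # w \<in> tidx (Suc d) \<longleftrightarrow> a \<in> {0, 1} \<and> w \<in> tidx d"
  by (auto simp: tidx_def)

lemma tidx_Suc: "tidx (Suc d) = (#) 0 ` tidx d \<union> (#) 1 ` tidx d"
  by (auto simp: tidx_def length_Suc_conv image_iff)

lemma finite_tidx [simp]: "finite (tidx d)"
  by (induction d) (simp_all add: tidx_Suc)

lemma sum_tidx_Suc:
  fixes f :: "nat list \<Rightarrow> rat"
  shows "sum f (tidx (Suc d)) = (\<Sum>w\<in>tidx d. f (0 # w) + f (1 # w))"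
  unfolding tidx_Suc by (subst sum.union_disjoint) (auto simp: sum.reindex sum.distrib)

lemma tidx_induct2 [consumes 2, case_names Nil Cons]:
  assumes "i \<in> tidx d" "j \<in> tidx d"
    and "P 0 [] []"
    and "\<And>d a b i j. a \<in> {0, 1} \<Longrightarrow> b \<in> {0, 1} \<Longrightarrow> i \<in> tidx d \<Longrightarrow> j \<in> tidx d \<Longrightarrow> P d i j
      \<Longrightarrow> P (Suc d) (a # i) (b # j)"
  shows "P d i j"
  using assms(1,2)
proof (induction d arbitrary: i j)
  case 0
  then show ?case using assms(3) by simp
next
  case (Suc d)
  then obtain a i' b j' where "i = a # i'" "j = b # j'"
    by (auto simp: tidx_Suc)
  with Suc show ?case using assms(4) by simp
qed

text \<open>A \<open>mat\<close> is a function on all pairs of lists. Vanishing off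
  \<open>tidx d\<close> singles out the genuine endomorphisms, whose equality can be tested on
  \<open>tidx d\<close> and for which \<open>mat_one d\<close> is a unit.\<close>

definition mat_supp :: "nat \<Rightarrow> mat \<Rightarrow> bool" where
  "mat_supp d M \<longleftrightarrow> (\<forall>i j. M i j \<noteq> 0 \<longrightarrow> i \<in> tidx d \<and> j \<in> tidx d)"

lemma mat_supp_eqI:
  assumes "mat_supp d A" "mat_supp d B" "\<And>i j. i \<in> tidx d \<Longrightarrow> j \<in> tidx d \<Longrightarrow> A i j = B i j"
  shows "A = B"
  using assms unfolding mat_supp_def fun_eq_iff by metis

lemma mat_supp_add: "mat_supp d A \<Longrightarrow> mat_supp d B \<Longrightarrow> mat_supp d (A + B)"
  and mat_supp_diff: "mat_supp d A \<Longrightarrow> mat_supp d B \<Longrightarrow> mat_supp d (A - B)"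
  and mat_supp_scale: "mat_supp d A \<Longrightarrow> mat_supp d (mscale c A)"
  and mat_supp_one: "mat_supp d (mat_one d)"
  and mat_supp_tensor: "mat_supp d (tensor_power d g)"
  by (auto simp: mat_supp_def mscale_def mat_one_def tensor_power_def fun_apply)
    (metis add.right_neutral diff_0_right)+

lemma mat_supp_mult:
  assumes "mat_supp d A" "mat_supp d B"
  shows "mat_supp d (mat_mult d A B)"
  unfolding mat_supp_def
proof (intro allI impI)
  fix i j assume "mat_mult d A B i j \<noteq> 0"
  then obtain k where "A i k * B k j \<noteq> 0"
    unfolding mat_mult_def by (meson sum.not_neutral_contains_not_neutral)
  with assms show "i \<in> tidx d \<and> j \<in> tidx d" unfolding mat_supp_def by auto
qed

lemma mat_mult_linear:
  "mat_mult d (A + B) C = mat_mult d A C + mat_mult d B C"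
  "mat_mult d C (A + B) = mat_mult d C A + mat_mult d C B"
  "mat_mult d (mscale c A) C = mscale c (mat_mult d A C)"
  "mat_mult d C (mscale c A) = mscale c (mat_mult d C A)"
  "mat_mult d 0 C = 0" "mat_mult d C 0 = 0"
  by (auto simp: mat_mult_def mscale_def fun_eq_iff fun_apply ring_distribs sum.distrib
      sum_distrib_left mult_ac)

lemma mat_mult_assoc: "mat_mult d (mat_mult d A B) C = mat_mult d A (mat_mult d B C)"
proof (intro ext)
  fix i j
  show "mat_mult d (mat_mult d A B) C i j = mat_mult d A (mat_mult d B C) i j"
    unfolding mat_mult_def sum_distrib_left sum_distrib_right mult.assoc by (rule sum.swap)
qed

lemma mat_mult_one:
  assumes "mat_supp d A"
  shows "mat_mult d (mat_one d) A = A" "mat_mult d A (mat_one d) = A"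
proof -
  have "(\<Sum>k\<in>tidx d. mat_one d i k * A k j) = A i j" for i j
  proof -
    have "(\<Sum>k\<in>tidx d. mat_one d i k * A k j) = (\<Sum>k\<in>tidx d. if k = i then A i j else 0)"
      by (intro sum.cong) (auto simp: mat_one_def)
    also have "\<dots> = A i j" using assms by (auto simp: mat_supp_def)
    finally show ?thesis .
  qed
  then show "mat_mult d (mat_one d) A = A" by (simp add: mat_mult_def)
  have "(\<Sum>k\<in>tidx d. A i k * mat_one d k j) = A i j" for i j
  proof -
    have "(\<Sum>k\<in>tidx d. A i k * mat_one d k j) = (\<Sum>k\<in>tidx d. if k = j then A i j else 0)"
      by (intro sum.cong) (auto simp: mat_one_def)
    also have "\<dots> = A i j" using assms by (auto simp: mat_supp_def)
    finally show ?thesis .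
  qed
  then show "mat_mult d A (mat_one d) = A" by (simp add: mat_mult_def)
qed

text \<open>The derivation \<open>\<Sum>k. 1 \<otimes> \<dots> \<otimes> X \<otimes> \<dots> \<otimes> 1\<close> (with \<open>X\<close> in position \<open>k\<close>), peeled off factor by factor.\<close>

fun lie_entry :: "(nat \<Rightarrow> nat \<Rightarrow> rat) \<Rightarrow> nat list \<Rightarrow> nat list \<Rightarrow> rat" where
  "lie_entry X (a # i) (b # j) =
    X a b * (if i = j then 1 else 0) + (if a = b then 1 else 0) * lie_entry X i j"
| "lie_entry X _ _ = 0"

definition lie_rep :: "nat \<Rightarrow> (nat \<Rightarrow> nat \<Rightarrow> rat) \<Rightarrow> mat" where
  "lie_rep d X = (\<lambda>i j. if i \<in> tidx d \<and> j \<in> tidx d then lie_entry X i j else 0)"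

lemma mat_supp_lie: "mat_supp d (lie_rep d X)"
  by (simp add: mat_supp_def lie_rep_def)

lemma lie_rep_Cons:
  assumes "a \<in> {0, 1}" "b \<in> {0, 1}" "i \<in> tidx d" "j \<in> tidx d"
  shows "lie_rep (Suc d) X (a # i) (b # j) =
    X a b * (if i = j then 1 else 0) + (if a = b then 1 else 0) * lie_rep d X i j"
  using assms by (simp add: lie_rep_def)

text \<open>This multiplies out \<open>(x 1 + p A)(y 1 + q B)\<close>, the shape of the blocks once
  the first tensor factor is split off.\<close>

lemma sum_product_delta:
  fixes A B :: "'a \<Rightarrow> rat"
  assumes "finite T" "i \<in> T" "j \<in> T"
  shows "(\<Sum>w\<in>T. (x * (if i = w then 1 else 0) + p * A w) * (y * (if w = j then 1 else 0) + q * B w))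
    = x * y * (if i = j then 1 else 0) + x * q * B i + p * y * A j + p * q * (\<Sum>w\<in>T. A w * B w)"
proof -
  have "(x * (if i = w then 1 else 0) + p * A w) * (y * (if w = j then 1 else 0) + q * B w)
    = (if w = i then x * y * (if i = j then 1 else 0) + x * q * B i else 0)
      + (if w = j then p * y * A j else 0) + p * q * (A w * B w)" for w
    by (auto simp: algebra_simps)
  then show ?thesis
    using assms by (simp add: sum.distrib flip: sum_distrib_left)
qed

text \<open>The action of \<open>X\<close> splits as \<open>X \<otimes> 1 + 1 \<otimes> X\<close>,
  with \<open>X\<close> acting on the remaining factors in the second term. The two mixed terms of
  the product are together symmetric in \<open>X\<close> and \<open>Y\<close>, so they cancel in the
  commutator.\<close>

lemma lie_mult_Cons:
  assumes "a \<in> {0, 1}" "b \<in> {0, 1}" "i \<in> tidx d" "j \<in> tidx d"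
  shows "mat_mult (Suc d) (lie_rep (Suc d) X) (lie_rep (Suc d) Y) (a # i) (b # j) =
    (X a 0 * Y 0 b + X a 1 * Y 1 b) * (if i = j then 1 else 0)
    + X a b * lie_rep d Y i j + Y a b * lie_rep d X i j
    + (if a = b then 1 else 0) * mat_mult d (lie_rep d X) (lie_rep d Y) i j"
proof -
  have "mat_mult (Suc d) (lie_rep (Suc d) X) (lie_rep (Suc d) Y) (a # i) (b # j) =
    (\<Sum>w\<in>tidx d.
      (X a 0 * (if i = w then 1 else 0) + (if a = 0 then 1 else 0) * lie_rep d X i w)
      * (Y 0 b * (if w = j then 1 else 0) + (if 0 = b then 1 else 0) * lie_rep d Y w j))
    + (\<Sum>w\<in>tidx d.
      (X a 1 * (if i = w then 1 else 0) + (if a = 1 then 1 else 0) * lie_rep d X i w)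
      * (Y 1 b * (if w = j then 1 else 0) + (if 1 = b then 1 else 0) * lie_rep d Y w j))"
    unfolding mat_mult_def sum_tidx_Suc sum.distrib[symmetric]
    by (intro sum.cong refl) (use assms in \<open>simp only: lie_rep_Cons insert_iff simp_thms\<close>)
  also have "\<dots> = (X a 0 * Y 0 b + X a 1 * Y 1 b) * (if i = j then 1 else 0)
    + X a b * lie_rep d Y i j + Y a b * lie_rep d X i j
    + (if a = b then 1 else 0) * mat_mult d (lie_rep d X) (lie_rep d Y) i j"
    unfolding sum_product_delta[OF finite_tidx assms(3,4)] mat_mult_def
    using assms(1,2) by (auto simp: algebra_simps)
  finally show ?thesis .
qed

lemma lie_rep_bracket:
  "mat_mult d (lie_rep d X) (lie_rep d Y) - mat_mult d (lie_rep d Y) (lie_rep d X)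
    = lie_rep d (\<lambda>a b. X a 0 * Y 0 b + X a 1 * Y 1 b - (Y a 0 * X 0 b + Y a 1 * X 1 b))"
proof (rule mat_supp_eqI[of d])
  fix i j assume "i \<in> tidx d" "j \<in> tidx d"
  then show "(mat_mult d (lie_rep d X) (lie_rep d Y) - mat_mult d (lie_rep d Y) (lie_rep d X)) i j
    = lie_rep d (\<lambda>a b. X a 0 * Y 0 b + X a 1 * Y 1 b - (Y a 0 * X 0 b + Y a 1 * X 1 b)) i j"
  proof (induction rule: tidx_induct2)
    case Nil
    then show ?case by (simp add: mat_mult_def lie_rep_def fun_apply)
  next
    case (Cons d a b i j)
    then show ?case
      by (simp only: fun_apply lie_mult_Cons lie_rep_Cons) (simp add: algebra_simps)
  qed
qed (intro mat_supp_diff mat_supp_mult mat_supp_lie)+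

lemma lie_rep_linear:
  "lie_rep d (\<lambda>a b. x * X a b + y * Y a b) = mscale x (lie_rep d X) + mscale y (lie_rep d Y)"
proof (rule mat_supp_eqI[of d])
  fix i j assume "i \<in> tidx d" "j \<in> tidx d"
  then show "lie_rep d (\<lambda>a b. x * X a b + y * Y a b) i j
      = (mscale x (lie_rep d X) + mscale y (lie_rep d Y)) i j"
  proof (induction rule: tidx_induct2)
    case Nil
    then show ?case by (simp add: mscale_def lie_rep_def fun_apply)
  next
    case (Cons d a b i j)
    then show ?case
      by (simp add: fun_apply mscale_def lie_rep_Cons algebra_simps)
  qed
qed (intro mat_supp_add mat_supp_scale mat_supp_lie)+

lemma lie_rep_cong:
  assumes "\<And>a b. a \<in> {0, 1} \<Longrightarrow> b \<in> {0, 1} \<Longrightarrow> X a b = Y a b"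
  shows "lie_rep d X = lie_rep d Y"
proof (rule mat_supp_eqI[of d])
  fix i j assume "i \<in> tidx d" "j \<in> tidx d"
  then show "lie_rep d X i j = lie_rep d Y i j"
  proof (induction rule: tidx_induct2)
    case (Cons d a b i j)
    then show ?case using assms[of a b] by (simp only: lie_rep_Cons)
  qed (simp add: lie_rep_def)
qed (rule mat_supp_lie)+

lemma lie_rep_diag:
  "lie_rep d (\<lambda>a b. if a = b then x a else 0)
    = (\<lambda>i j. if i = j \<and> i \<in> tidx d then \<Sum>a\<leftarrow>i. x a else 0)"
proof (rule mat_supp_eqI[of d])
  fix i j assume "i \<in> tidx d" "j \<in> tidx d"
  then show "lie_rep d (\<lambda>a b. if a = b then x a else 0) i j
      = (if i = j \<and> i \<in> tidx d then \<Sum>a\<leftarrow>i. x a else 0)"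
  proof (induction rule: tidx_induct2)
    case (Cons d a b i j)
    then show ?case by (auto simp: lie_rep_Cons)
  qed (simp add: lie_rep_def)
qed (rule mat_supp_lie, auto simp: mat_supp_def)

definition elem :: "nat \<Rightarrow> nat \<Rightarrow> nat \<Rightarrow> nat \<Rightarrow> rat" where
  "elem p q = (\<lambda>a b. if a = p \<and> b = q then 1 else 0)"

lemma lie_rep_h:
  "lie_rep d (elem 0 0) = (\<lambda>i j. if i = j \<and> i \<in> tidx d then of_nat (count_list i 0) else 0)"
proof -
  have eq: "elem 0 0 = (\<lambda>a b. if a = b then if a = 0 then 1 else 0 else 0)"
    by (auto simp: elem_def fun_eq_iff)
  have "(\<Sum>a\<leftarrow>i. if a = 0 then 1 else 0) = (of_nat (count_list i 0) :: rat)" for i :: "nat list"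
    by (induction i) auto
  note s = this
  show ?thesis unfolding eq lie_rep_diag s ..
qed

lemma lie_rep_id: "lie_rep d (\<lambda>a b. if a = b then 1 else 0) = mscale (of_nat d) (mat_one d)"
  unfolding lie_rep_diag by (auto simp: mscale_def mat_one_def fun_eq_iff sum_list_triv tidx_def)

section \<open>The representation of the free algebra and its relations\<close>

fun gen_elem :: "gen \<Rightarrow> nat \<Rightarrow> nat \<Rightarrow> rat" where
  "gen_elem Ge = elem 0 1"
| "gen_elem Gf = elem 1 0"
| "gen_elem Gh = elem 0 0"

definition word_rep :: "nat \<Rightarrow> gen list \<Rightarrow> mat" where
  "word_rep d w = foldr (\<lambda>x. mat_mult d (lie_rep d (gen_elem x))) w (mat_one d)"

lemma mat_supp_word: "mat_supp d (word_rep d w)"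
  unfolding word_rep_def
  by (induction w) (simp_all add: mat_supp_one mat_supp_mult mat_supp_lie)

lemma word_rep_simps [simp]:
  "word_rep d [] = mat_one d"
  "word_rep d (x # w) = mat_mult d (lie_rep d (gen_elem x)) (word_rep d w)"
  by (simp_all add: word_rep_def)

lemma word_rep_append: "word_rep d (u @ v) = mat_mult d (word_rep d u) (word_rep d v)"
  by (induction u) (simp_all add: mat_mult_one mat_supp_word mat_mult_assoc)

text \<open>Linear extension from words. For infinite support the sum defaults to 0, hence the
  carrier assumptions in the linearity rules.\<close>

definition rep :: "nat \<Rightarrow> fa \<Rightarrow> mat" where
  "rep d p = (\<lambda>i j. \<Sum>w | p w \<noteq> 0. p w * word_rep d w i j)"

lemma rep_superset:
  assumes "finite A" "{w. p w \<noteq> 0} \<subseteq> A"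
  shows "rep d p i j = (\<Sum>w\<in>A. p w * word_rep d w i j)"
  unfolding rep_def using assms by (intro sum.mono_neutral_left) auto

lemma rep_add:
  assumes "p \<in> fa_carrier" "q \<in> fa_carrier"
  shows "rep d (p + q) = rep d p + rep d q"
proof (intro ext)
  fix i j
  let ?A = "{w. p w \<noteq> 0} \<union> {w. q w \<noteq> 0}"
  have fin: "finite ?A" using assms by (simp add: fa_carrier_def)
  have "rep d (p + q) i j = (\<Sum>w\<in>?A. (p + q) w * word_rep d w i j)"
    "rep d p i j = (\<Sum>w\<in>?A. p w * word_rep d w i j)"
    "rep d q i j = (\<Sum>w\<in>?A. q w * word_rep d w i j)"
    by (intro rep_superset fin; auto simp: fun_apply)+
  then show "rep d (p + q) i j = (rep d p + rep d q) i j"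
    by (simp add: fun_apply sum.distrib algebra_simps)
qed

lemma rep_scale: "p \<in> fa_carrier \<Longrightarrow> rep d (fa_smult c p) = mscale c (rep d p)"
  unfolding fun_eq_iff mscale_def
  by (subst rep_superset[of "{w. p w \<noteq> 0}"])
    (auto simp: fa_carrier_def fa_smult_def rep_def sum_distrib_left mult_ac)

lemma rep_zero [simp]: "rep d 0 = 0"
  by (simp add: rep_def fun_eq_iff fun_apply)

lemma rep_diff:
  assumes "p \<in> fa_carrier" "q \<in> fa_carrier"
  shows "rep d (p - q) = rep d p - rep d q"
  using rep_add[of "p - q" q d] assms by (simp add: algebra_simps)

lemma rep_mon [simp]: "rep d (fa_mon w) = word_rep d w"
  by (intro ext) (subst rep_superset[of "{w}"], auto simp: fa_mon_def)

lemma rep_mult: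
  assumes "p \<in> fa_carrier" "q \<in> fa_carrier"
  shows "rep d (fa_mult p q) = mat_mult d (rep d p) (rep d q)"
  using assms(1)
proof (induction p rule: fa_carrier_induct)
  case zero
  then show ?case by (simp add: fa_mult_linear mat_mult_linear)
next
  case (step c u p)
  have "rep d (fa_mult (fa_mon u) q) = mat_mult d (rep d (fa_mon u)) (rep d q)"
    using assms(2)
    by (induction q rule: fa_carrier_induct)
      (simp_all add: fa_mult_linear mat_mult_linear rep_add rep_scale fa_mult_mon word_rep_append)
  with step assms(2) show ?case
    by (simp add: fa_mult_linear mat_mult_linear rep_add rep_scale)
qed

lemma rep_gen: "rep d (fa_gen x) = lie_rep d (gen_elem x)"
  by (simp add: fa_gen_def mat_mult_one mat_supp_lie)

lemma rep_one: "rep d fa_one = mat_one d"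
  by (simp add: fa_one_def)

lemma rep_hprod:
  "rep d (hprod n) =
    (\<lambda>i j. if i = j \<and> i \<in> tidx d then \<Prod>k\<le>n. of_nat (count_list i 0) - of_nat k else 0)"
proof (induction n)
  case 0
  then show ?case by (auto simp: rep_gen lie_rep_h fun_eq_iff)
next
  case (Suc n)
  have "rep d (hprod (Suc n)) i j =
      (if i = j \<and> i \<in> tidx d then \<Prod>k\<le>Suc n. of_nat (count_list i 0) - of_nat k else 0)" for i j
  proof -
    have "rep d (hprod (Suc n)) i j = (\<Sum>k\<in>tidx d. rep d (hprod n) i k *
        (lie_rep d (elem 0 0) k j - of_nat (Suc n) * mat_one d k j))"
      by (simp add: fa_ops rep_mult rep_diff rep_scale rep_gen rep_one mat_mult_def fun_apply
          mscale_def del: of_nat_Suc)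
    also have "\<dots> = (\<Sum>k\<in>tidx d. if k = i then if i = j
        then (\<Prod>k\<le>Suc n. of_nat (count_list i 0) - of_nat k) else 0 else 0)"
      by (intro sum.cong) (auto simp: Suc lie_rep_h mat_one_def)
    finally show ?thesis by auto
  qed
  then show ?case by (simp add: fun_eq_iff)
qed

lemma rep_rels:
  assumes "r \<in> rels d"
  shows "rep d r = 0"
proof -
  let ?L = "lie_rep d"
  have 1: "?L (elem 0 1) = mat_mult d (?L (elem 0 0)) (?L (elem 0 1))
      - mat_mult d (?L (elem 0 1)) (?L (elem 0 0))"
    unfolding lie_rep_bracket by (rule lie_rep_cong) (auto simp: elem_def)
  have 2: "mat_mult d (?L (elem 0 1)) (?L (elem 1 0)) - mat_mult d (?L (elem 1 0)) (?L (elem 0 1))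
      = mscale 2 (?L (elem 0 0)) - mscale (of_nat d) (mat_one d)"
  proof -
    \<comment> \<open>The bracket is \<open>E_11 - E_22 = 2 E_11 - 1\<close>, and the identity
      matrix acts as the scalar \<open>d\<close>; this is where the \<open>- d\<close> of the
      relation comes from.\<close>
    have "mat_mult d (?L (elem 0 1)) (?L (elem 1 0)) - mat_mult d (?L (elem 1 0)) (?L (elem 0 1))
      = ?L (\<lambda>a b. 2 * elem 0 0 a b + (- 1) * (if a = b then 1 else 0))"
      unfolding lie_rep_bracket by (rule lie_rep_cong) (auto simp: elem_def)
    then show ?thesis unfolding lie_rep_linear lie_rep_id by simp
  qed
  have 3: "mat_mult d (?L (elem 0 0)) (?L (elem 1 0)) - mat_mult d (?L (elem 1 0)) (?L (elem 0 0))
      = - ?L (elem 1 0)"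
  proof -
    have "mat_mult d (?L (elem 0 0)) (?L (elem 1 0)) - mat_mult d (?L (elem 1 0)) (?L (elem 0 0))
      = ?L (\<lambda>a b. (- 1) * elem 1 0 a b + 0 * elem 1 0 a b)"
      unfolding lie_rep_bracket by (rule lie_rep_cong) (auto simp: elem_def)
    then show ?thesis unfolding lie_rep_linear by simp
  qed
  have 4: "rep d (hprod d) = 0"
  proof -
    \<comment> \<open>The number of zeros in an index of length \<open>d\<close> lies between 0 and
      \<open>d\<close>, so one of the \<open>d + 1\<close> factors vanishes.\<close>
    have "(\<Prod>k\<le>d. of_nat (count_list i 0) - (of_nat k :: rat)) = 0" if "i \<in> tidx d" for i
    proof (rule prod_zero)
      show "\<exists>k\<in>{..d}. of_nat (count_list i 0) - (of_nat k :: rat) = 0"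
        using that count_le_length[of i 0] by (intro bexI[of _ "count_list i 0"]) (auto simp: tidx_def)
    qed simp
    then show ?thesis by (auto simp: rep_hprod fun_eq_iff fun_apply)
  qed
  show ?thesis
    using assms 4 1[symmetric] 2 3
    by (auto simp: rels_def rel1_def rel2_def rel3_def fa_ops rep_add rep_diff rep_scale rep_mult
        rep_gen rep_one)
qed

lemma rep_ideal:
  assumes "p \<in> fa_ideal (rels d)"
  shows "rep d p = 0"
proof -
  have "p \<in> fa_carrier \<and> rep d p = 0"
    using assms
  proof induction
    case (gen r u v)
    with rels_carrier have "r \<in> fa_carrier" by auto
    with rep_rels[OF gen] show ?case by (simp add: rep_mult mat_mult_linear)
  qed (simp_all add: fa_ops rep_add rep_scale)
  then show ?thesis ..
qed

section \<open>Divided powers and the matrix entries of ordered monomials\<close>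

text \<open>The divided power \<open>\<rho>(E\<^sub>p\<^sub>q)^k / k!\<close>.\<close>

definition dpow :: "nat \<Rightarrow> nat \<Rightarrow> nat \<Rightarrow> nat \<Rightarrow> mat" where
  "dpow p q d k = (\<lambda>i j. if i \<in> tidx d \<and> j \<in> tidx d \<and>
      list_all2 (\<lambda>x y. x = y \<or> x = p \<and> y = q) i j \<and> count_list i p = count_list j p + k
    then 1 else 0)"

text \<open>In the recursion for \<open>dpow\<close> this rules out \<open>k = 0\<close> when the
  first entries are \<open>p\<close> and \<open>q\<close>.\<close>

lemma count_list_all2_le:
  assumes "list_all2 (\<lambda>x y. x = y \<or> x = p \<and> y = q) i j" "p \<noteq> q"
  shows "count_list j p \<le> count_list i p"
  using assms(1) by induction (use assms(2) in auto)

text \<open>The matrix unit squares to zero, so the first factor is changed at most once, leaving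
  \<open>k\<close> or \<open>k - 1\<close> changes for the others.\<close>

lemma dpow_Cons:
  assumes "p \<noteq> q" "a \<in> {0, 1}" "b \<in> {0, 1}" "i \<in> tidx d" "j \<in> tidx d"
  shows "dpow p q (Suc d) k (a # i) (b # j) =
    (if a = b then dpow p q d k i j else 0) +
    (if a = p \<and> b = q \<and> k > 0 then dpow p q d (k - 1) i j else 0)"
  using assms count_list_all2_le[of p q i j] by (auto simp: dpow_def)

lemma mat_supp_dpow: "mat_supp d (dpow p q d k)"
  by (simp add: mat_supp_def dpow_def)

lemma dpow_0:
  assumes "p \<noteq> q"
  shows "dpow p q d 0 = mat_one d"
proof (rule mat_supp_eqI[of d])
  fix i j assume "i \<in> tidx d" "j \<in> tidx d"
  then show "dpow p q d 0 i j = mat_one d i j"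
  proof (induction rule: tidx_induct2)
    case Nil
    then show ?case by (simp add: dpow_def mat_one_def)
  next
    case (Cons d a b i j)
    then show ?case by (auto simp: dpow_Cons[OF assms] mat_one_def)
  qed
qed (rule mat_supp_dpow mat_supp_one)+

lemma sum_tidx_delta:
  fixes f :: "nat list \<Rightarrow> rat"
  assumes "i \<in> tidx d"
  shows "(\<Sum>w\<in>tidx d. x * (if i = w then 1 else 0) * f w) = x * f i"
proof -
  have "(\<Sum>w\<in>tidx d. x * (if i = w then 1 else 0) * f w) = (\<Sum>w\<in>tidx d. if w = i then x * f i else 0)"
    by (intro sum.cong) auto
  then show ?thesis using assms by simp
qed

lemma lie_mult_left_Cons:
  assumes "a \<in> {0, 1}" "i \<in> tidx d"
  shows "mat_mult (Suc d) (lie_rep (Suc d) X) M (a # i) j =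
    X a 0 * M (0 # i) j + X a 1 * M (1 # i) j + (\<Sum>w\<in>tidx d. lie_rep d X i w * M (a # w) j)"
proof -
  have "mat_mult (Suc d) (lie_rep (Suc d) X) M (a # i) j =
    (\<Sum>w\<in>tidx d. X a 0 * (if i = w then 1 else 0) * M (0 # w) j
      + X a 1 * (if i = w then 1 else 0) * M (1 # w) j + lie_rep d X i w * M (a # w) j)"
    unfolding mat_mult_def sum_tidx_Suc
    by (intro sum.cong refl) (use assms in \<open>auto simp: lie_rep_Cons algebra_simps\<close>)
  then show ?thesis by (simp only: sum.distrib sum_tidx_delta[OF assms(2)])
qed

text \<open>This is \<open>E * E^k / k! = (k+1) * E^(k+1) / (k+1)!\<close>. Where the first factor
  changes, one copy comes from acting on it and \<open>k\<close> copies from acting on the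
  others.\<close>

lemma lie_mult_dpow:
  assumes "p \<noteq> q" "p \<in> {0, 1}" "q \<in> {0, 1}"
  shows "mat_mult d (lie_rep d (elem p q)) (dpow p q d k)
    = mscale (of_nat (Suc k)) (dpow p q d (Suc k))"
proof (rule mat_supp_eqI[of d])
  fix i j assume "i \<in> tidx d" "j \<in> tidx d"
  then show "mat_mult d (lie_rep d (elem p q)) (dpow p q d k) i j
      = mscale (of_nat (Suc k)) (dpow p q d (Suc k)) i j"
  proof (induction arbitrary: k rule: tidx_induct2)
    case Nil
    then show ?case by (simp add: mat_mult_def mscale_def dpow_def lie_rep_def)
  next
    case (Cons d a b i j)
    let ?L = "lie_rep d (elem p q)" and ?D = "dpow p q d"
    have IH: "(\<Sum>w\<in>tidx d. ?L i w * ?D k w j) = of_nat (Suc k) * ?D (Suc k) i j" for k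
      using Cons.IH[of k] by (simp add: mat_mult_def mscale_def)
    have "(\<Sum>w\<in>tidx d. ?L i w * dpow p q (Suc d) k (a # w) (b # j))
      = (if a = b then \<Sum>w\<in>tidx d. ?L i w * ?D k w j else 0)
        + (if a = p \<and> b = q \<and> k > 0 then \<Sum>w\<in>tidx d. ?L i w * ?D (k - 1) w j else 0)"
      using Cons.hyps assms(1) by (cases "a = b") (auto simp: dpow_Cons intro!: sum.cong)
    \<comment> \<open>The guard \<open>k > 0\<close> disappears because the factor
      \<open>of_nat k\<close> vanishes at 0.\<close>
    also have "\<dots> = (if a = b then of_nat (Suc k) * ?D (Suc k) i j else 0)
        + (if a = p \<and> b = q then of_nat k * ?D k i j else 0)"
      unfolding IH by simp
    finally have "mat_mult (Suc d) (lie_rep (Suc d) (elem p q)) (dpow p q (Suc d) k) (a # i) (b # j)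
      = elem p q a 0 * dpow p q (Suc d) k (0 # i) (b # j)
        + elem p q a 1 * dpow p q (Suc d) k (1 # i) (b # j)
        + ((if a = b then of_nat (Suc k) * ?D (Suc k) i j else 0)
        + (if a = p \<and> b = q then of_nat k * ?D k i j else 0))"
      using Cons.hyps by (simp add: lie_mult_left_Cons)
    also have "\<dots> = of_nat (Suc k) * dpow p q (Suc d) (Suc k) (a # i) (b # j)"
      using assms Cons.hyps by (auto simp: dpow_Cons elem_def algebra_simps)
    finally show ?case by (simp add: mscale_def)
  qed
qed (intro mat_supp_mult mat_supp_lie mat_supp_dpow mat_supp_scale)+

lemma word_rep_replicate:
  assumes "gen_elem x = elem p q" "p \<noteq> q" "p \<in> {0, 1}" "q \<in> {0, 1}"
  shows "word_rep d (replicate k x) = mscale (fact k) (dpow p q d k)"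
proof (induction k)
  case 0
  then show ?case using assms(2) by (simp add: dpow_0)
next
  case (Suc k)
  then show ?case
    using assms
    by (simp add: mat_mult_linear lie_mult_dpow mult.commute del: of_nat_Suc fact_Suc)
      (simp add: mult.commute)
qed

lemma word_rep_h:
  "word_rep d (replicate b Gh)
    = (\<lambda>i j. if i = j \<and> i \<in> tidx d then of_nat (count_list i 0) ^ b else 0)"
proof (induction b)
  case 0
  show ?case by (auto simp: mat_one_def fun_eq_iff)
next
  case (Suc b)
  have "word_rep d (replicate (Suc b) Gh) i j
      = (\<Sum>k\<in>tidx d. if k = i then if i = j then of_nat (count_list i 0) ^ Suc b else 0 else 0)"
    for i j
    unfolding replicate_Suc word_rep_simps Suc gen_elem.simps lie_rep_h mat_mult_def
    by (intro sum.cong) auto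
  then show ?case by (auto simp: fun_eq_iff)
qed

text \<open>Powers of \<open>h\<close> are diagonal, so a single intermediate index \<open>m\<close>
  remains, weighted by a power of its number of zeros.\<close>

lemma word_rep_pbw:
  "word_rep d (replicate a Ge @ replicate b Gh @ replicate c Gf) i j
    = (\<Sum>m\<in>tidx d. fact a * dpow 0 1 d a i m * of_nat (count_list m 0) ^ b
        * (fact c * dpow 1 0 d c m j))"
proof -
  have "mat_mult d (word_rep d (replicate b Gh)) (word_rep d (replicate c Gf)) m j
      = of_nat (count_list m 0) ^ b * (fact c * dpow 1 0 d c m j)" if "m \<in> tidx d" for m
  proof -
    have "mat_mult d (word_rep d (replicate b Gh)) (word_rep d (replicate c Gf)) m j
        = (\<Sum>k\<in>tidx d. if k = m then of_nat (count_list m 0) ^ b * (fact c * dpow 1 0 d c m j) else 0)"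
      unfolding mat_mult_def word_rep_h word_rep_replicate[of Gf 1 0, simplified] mscale_def
      by (intro sum.cong) auto
    then show ?thesis using that by simp
  qed
  then show ?thesis
    unfolding word_rep_append word_rep_replicate[of Ge 0 1, simplified]
    by (subst mat_mult_def) (simp add: mscale_def mult.assoc)
qed

lemma pbw_comb_sum:
  "pbw_comb d c = (\<Sum>(a,b,k)\<in>{(a,b,k). a + b + k \<le> d}. fa_smult (c (a,b,k)) (pbw_mon a b k))"
  by (simp add: pbw_comb_def fun_eq_iff sum_apply fa_smult_def split_beta)

lemma pbw_mon_carrier [simp]: "pbw_mon a b k \<in> fa_carrier"
  by (simp add: pbw_mon_def)

lemma rep_sum:
  assumes "\<And>x. x \<in> A \<Longrightarrow> F x \<in> fa_carrier"
  shows "rep d (\<Sum>x\<in>A. F x) = (\<Sum>x\<in>A. rep d (F x))"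
proof -
  have "(\<Sum>x\<in>A. F x) \<in> fa_carrier \<and> ?thesis"
    using assms by (induction A rule: infinite_finite_induct) (simp_all add: rep_add)
  then show ?thesis ..
qed

lemma pbw_comb_carrier: "pbw_comb d c \<in> fa_carrier"
  unfolding pbw_comb_sum by (intro fa.subspace_sum fa_carrier_subspace) auto

lemma rep_pbw_comb:
  "rep d (pbw_comb d c) i j = (\<Sum>(a,b,k)\<in>{(a,b,k). a + b + k \<le> d}.
      c (a,b,k) * rep d (pbw_mon a b k) i j)"
  unfolding pbw_comb_sum
  by (subst rep_sum) (auto simp: sum_apply rep_scale mscale_def split_beta)

section \<open>Linear independence\<close>

lemma count_list_eq_length:
  "count_list xs x = length xs \<Longrightarrow> xs = replicate (length xs) x"
proof (induction xs)
  case (Cons y xs)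
  then show ?case using count_le_length[of xs x] by (auto split: if_splits)
qed simp

lemma count_list_replicate: "count_list (replicate n x) y = (if x = y then n else 0)"
  by (induction n) auto

text \<open>Bounds the number of zeros of the intermediate index in the entries studied below and
  identifies that index in the extremal case.\<close>

lemma zeros_in_prefix:
  assumes "m \<in> tidx d" "s \<le> d" "\<And>n. s \<le> n \<Longrightarrow> n < d \<Longrightarrow> m ! n = 1"
  shows "count_list m 0 \<le> s"
    and "count_list m 0 = s \<Longrightarrow> m = replicate s 0 @ replicate (d - s) 1"
proof -
  have len: "length m = d" using assms(1) by (simp add: tidx_def)
  have m: "m = take s m @ replicate (d - s) 1"
    using assms len by (intro nth_equalityI) (auto simp: nth_append)
  have cnt: "count_list m 0 = count_list (take s m) 0"
    by (subst m) (simp add: count_list_replicate)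
  show "count_list m 0 \<le> s"
    using cnt count_le_length[of "take s m" 0] by simp
  assume "count_list m 0 = s"
  then have "take s m = replicate s 0"
    using cnt count_list_eq_length[of "take s m" 0] len assms(2) by (simp add: min_def)
  with m show "m = replicate s 0 @ replicate (d - s) 1" by simp
qed

text \<open>A polynomial of degree at most \<open>n\<close> with \<open>n + 1\<close> distinct roots
  is zero.\<close>

lemma poly_zero_on_initial_nats:
  fixes f :: "nat \<Rightarrow> rat"
  assumes "\<And>s. s \<le> n \<Longrightarrow> (\<Sum>b\<le>n. f b * of_nat s ^ b) = 0" "b \<le> n"
  shows "f b = 0"
proof -
  let ?p = "\<Sum>b\<le>n. monom (f b) b"
  have "?p = 0"
  proof (rule poly_eqI_degree[of "of_nat ` {..n}"])
    show "poly ?p x = poly 0 x" if "x \<in> of_nat ` {..n}" for x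
      using that assms(1) by (auto simp: poly_sum poly_monom)
    have "degree ?p \<le> n"
      by (intro degree_sum_le) (auto intro: degree_monom_le[THEN order_trans])
    moreover have "card (of_nat ` {..n} :: rat set) = Suc n"
      by (subst card_image) (auto simp: inj_on_def)
    ultimately show "degree ?p < card (of_nat ` {..n} :: rat set)"
      "degree (0::rat poly) < card (of_nat ` {..n} :: rat set)" by auto
  qed
  then show ?thesis using coeff_sum_monom[OF assms(2), of f] by simp
qed

text \<open>The entry at \<open>i = 0^(s+a) 1^(k+r)\<close>, \<open>j = 0^s 1^a 0^k 1^r\<close> only sees the monomials
  \<open>e^a' h^b f^k'\<close> with \<open>a' + k' > a + k\<close> or \<open>(a', k') = (a, k)\<close>, because all zeros of the
  intermediate index lie in the first block. Downward induction on \<open>a + k\<close> then leaves a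
  polynomial of degree at most \<open>d - a - k\<close> vanishing at \<open>s = 0, ..., d - a - k\<close>.\<close>

theorem pbw_independent:
  assumes "rep d (pbw_comb d C) = 0" "a + b + k \<le> d"
  shows "C (a, b, k) = 0"
  using assms(2)
proof (induction "d - (a + k)" arbitrary: a b k rule: less_induct)
  case less
  define N where "N = d - (a + k)"
  have "(\<Sum>b\<le>N. C (a, b, k) * of_nat s ^ b) = 0" if "s \<le> N" for s
  proof -
    \<comment> \<open>The parameter \<open>s\<close> is the point at which the polynomial is
      evaluated; \<open>r\<close> pads the indices to length \<open>d\<close>.\<close>
    define r where "r = N - s"
    have d: "d = s + a + k + r" using that less.prems by (simp add: r_def N_def)
    define i j m0 :: "nat list" where
      "i = replicate (s + a) 0 @ replicate (k + r) 1" and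
      "j = replicate s 0 @ replicate a 1 @ replicate k 0 @ replicate r 1" and
      "m0 = replicate s 0 @ replicate (d - s) 1"
    have ij: "i \<in> tidx d" "j \<in> tidx d" "m0 \<in> tidx d"
      by (auto simp: tidx_def i_def j_def m0_def d)
    have cnt: "count_list i 0 = s + a" "count_list m0 0 = s" "count_list m0 1 = a + k + r"
      "count_list j 1 = a + r" "count_list j 0 = s + k"
      by (simp_all add: i_def j_def m0_def count_list_replicate d)
    have total: "count_list w 0 + count_list w 1 = d" if "w \<in> tidx d" for w
      using that by (induction rule: tidx_induct2[OF that that]) auto
    have nz: "m = m0 \<and> a' = a \<and> k' = k"
      if m: "m \<in> tidx d" and "dpow 0 1 d a' i m \<noteq> 0" "dpow 1 0 d k' m j \<noteq> 0"
        and le: "a' + k' \<le> a + k" for m a' k'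
    proof -
      have im: "list_all2 (\<lambda>x y. x = y \<or> x = 0 \<and> y = 1) i m" "count_list i 0 = count_list m 0 + a'"
        and mj: "list_all2 (\<lambda>x y. x = y \<or> x = 1 \<and> y = 0) m j" "count_list m 1 = count_list j 1 + k'"
        using that by (auto simp: dpow_def split: if_splits)
      \<comment> \<open>On the block of length \<open>a\<close> after position \<open>s\<close> a 1
        in \<open>j\<close> forces a 1 in \<open>m\<close>; beyond that block a 1 in
        \<open>i\<close> does.\<close>
      have "m ! n = 1" if n: "s \<le> n" "n < d" for n
      proof (cases "n < s + a")
        case True
        then have "j ! n = 1" using n by (auto simp: j_def nth_append)
        with list_all2_nthD2[OF mj(1), of n] n ij show ?thesis by (auto simp: tidx_def)
      next
        case False
        then have "i ! n = 1" using n d by (auto simp: i_def nth_append)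
        with list_all2_nthD[OF im(1), of n] n ij show ?thesis by (auto simp: tidx_def)
      qed
      note prefix = zeros_in_prefix[OF m _ this]
      have "count_list m 0 \<le> s" using prefix(1) d by simp
      moreover have "s + a = count_list m 0 + a'" "d - count_list m 0 = a + r + k'"
        using im(2) mj(2) cnt total[OF m] by auto
      \<comment> \<open>At most \<open>s\<close> zeros in \<open>m\<close> gives
        \<open>a' \<ge> a\<close> and \<open>k' \<ge> k\<close>; the bound on \<open>a' + k'\<close>
        then forces equality throughout.\<close>
      ultimately have "count_list m 0 = s" "a' = a" "k' = k" using le d by auto
      with prefix(2) d show ?thesis by (simp add: m0_def)
    qed
    have one: "dpow 0 1 d a i m0 = 1" "dpow 1 0 d k m0 j = 1"
      using ij cnt by (auto simp: dpow_def list_all2_conv_all_nth i_def j_def m0_def nth_append d)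
    have entry: "C (a', b, k') * rep d (pbw_mon a' b k') i j
      = (if a' = a \<and> k' = k then fact a * fact k * (C (a, b, k) * of_nat s ^ b) else 0)"
      if idx: "a' + b + k' \<le> d" for a' b k'
    proof (cases "a' + k' \<le> a + k")
      case True
      have "rep d (pbw_mon a' b k') i j = (\<Sum>m\<in>tidx d. if m = m0 then
          if a' = a \<and> k' = k then fact a * fact k * of_nat s ^ b else 0 else 0)"
        unfolding pbw_mon_def rep_mon word_rep_pbw
      proof (intro sum.cong refl)
        fix m assume m: "m \<in> tidx d"
        show "fact a' * dpow 0 1 d a' i m * of_nat (count_list m 0) ^ b * (fact k' * dpow 1 0 d k' m j)
          = (if m = m0 then if a' = a \<and> k' = k then fact a * fact k * of_nat s ^ b else 0 else 0)"
          using nz[OF m _ _ True] one cnt(2)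
          by (cases "dpow 0 1 d a' i m = 0"; cases "dpow 1 0 d k' m j = 0") auto
      qed
      then show ?thesis using ij by simp
    next
      case False
      \<comment> \<open>Here \<open>a' + k'\<close> exceeds \<open>a + k\<close>, so the induction
        hypothesis applies.\<close>
      then have "C (a', b, k') = 0" using less idx by simp
      with False show ?thesis by auto
    qed
    have "0 = rep d (pbw_comb d C) i j" by (simp add: assms(1) fun_apply)
    also have "\<dots> = (\<Sum>(a',b,k')\<in>{(a',b,k'). a' + b + k' \<le> d}.
        if a' = a \<and> k' = k then fact a * fact k * (C (a, b, k) * of_nat s ^ b) else 0)"
      unfolding rep_pbw_comb by (intro sum.cong refl) (auto simp: entry)
    also have "\<dots> = (\<Sum>(a',b,k')\<in>(\<lambda>b. (a, b, k)) ` {..N}.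
        if a' = a \<and> k' = k then fact a * fact k * (C (a, b, k) * of_nat s ^ b) else 0)"
      using less.prems
      by (intro sum.mono_neutral_right finite_pbw_index) (auto simp: N_def image_iff)
    also have "\<dots> = fact a * fact k * (\<Sum>b\<le>N. C (a, b, k) * of_nat s ^ b)"
      by (subst sum.reindex) (auto simp: inj_on_def sum_distrib_left)
    finally show ?thesis by simp
  qed
  from poly_zero_on_initial_nats[OF this, of b] less.prems
  show ?case by (simp add: N_def)
qed

section \<open>The image\<close>

text \<open>Newton's scheme: \<open>w\<close> vanishes at \<open>0, ..., d\<close> but not at
  \<open>d + 1\<close>, so a multiple of it corrects the value at the new node.\<close>

lemma interpolation:
  "\<exists>p :: rat poly. degree p \<le> d \<and> (\<forall>n\<le>d. poly p (of_nat n) = y n)"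
proof (induction d)
  case 0
  show ?case by (intro exI[of _ "[:y 0:]"]) simp
next
  case (Suc d)
  then obtain p :: "rat poly" where p: "degree p \<le> d" "\<And>n. n \<le> d \<Longrightarrow> poly p (of_nat n) = y n" by auto
  define w :: "rat poly" where "w = (\<Prod>k\<le>d. [:- of_nat k, 1:])"
  have w0: "poly w (of_nat n) = 0" if "n \<le> d" for n
    using that by (auto simp: w_def poly_prod)
  have w1: "poly w (of_nat (Suc d)) \<noteq> 0"
    by (auto simp: w_def poly_prod simp flip: of_nat_Suc)
  have "degree w = Suc d"
    unfolding w_def by (subst degree_prod_eq_sum_degree) auto
  then have deg: "degree (smult c w) \<le> Suc d" for c by simp
  define c where "c = (y (Suc d) - poly p (of_nat (Suc d))) / poly w (of_nat (Suc d))"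
  show ?case
  proof (intro exI[of _ "p + smult c w"] conjI allI impI)
    show "degree (p + smult c w) \<le> Suc d"
      using p(1) deg by (intro degree_add_le) auto
    fix n assume "n \<le> Suc d"
    then show "poly (p + smult c w) (of_nat n) = y n"
      using p(2) w0 w1 by (cases "n = Suc d") (simp_all add: c_def del: of_nat_Suc)
  qed
qed

text \<open>The weights are the linear coefficients of the Lagrange polynomials \<open>L n\<close>.
  They recover a derivative at 0 from values at integers.\<close>

lemma linear_coeff_functional:
  "\<exists>u. \<forall>Q :: rat poly. degree Q \<le> d \<longrightarrow> coeff Q 1 = (\<Sum>n\<le>d. u n * poly Q (of_nat n))"
proof -
  have "\<forall>n. \<exists>p :: rat poly. degree p \<le> d \<and> (\<forall>m\<le>d. poly p (of_nat m) = (if m = n then 1 else 0))"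
    by (intro allI interpolation)
  from choice[OF this] obtain L :: "nat \<Rightarrow> rat poly" where L: "\<And>n. degree (L n) \<le> d"
    "\<And>n m. m \<le> d \<Longrightarrow> poly (L n) (of_nat m) = (if m = n then 1 else 0)" by blast
  have "coeff Q 1 = (\<Sum>n\<le>d. coeff (L n) 1 * poly Q (of_nat n))" if "degree Q \<le> d" for Q
  proof -
    have "Q = (\<Sum>n\<le>d. smult (poly Q (of_nat n)) (L n))"
    proof (rule poly_eqI_degree[of "of_nat ` {..d}"])
      show "poly Q x = poly (\<Sum>n\<le>d. smult (poly Q (of_nat n)) (L n)) x"
        if "x \<in> of_nat ` {..d}" for x
        using that by (auto simp: poly_sum L(2) if_distrib[of "(*) _"] cong: if_cong)
      have "card (of_nat ` {..d} :: rat set) = Suc d"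
        by (subst card_image) (auto simp: inj_on_def)
      moreover have "degree (\<Sum>n\<le>d. smult (poly Q (of_nat n)) (L n)) \<le> d"
        by (intro degree_sum_le) (use L(1) in \<open>auto intro: order_trans[OF degree_smult_le]\<close>)
      ultimately show "degree Q < card (of_nat ` {..d} :: rat set)"
        "degree (\<Sum>n\<le>d. smult (poly Q (of_nat n)) (L n)) < card (of_nat ` {..d} :: rat set)"
        using that by auto
    qed
    then have "coeff Q 1 = coeff (\<Sum>n\<le>d. smult (poly Q (of_nat n)) (L n)) 1" by simp
    then show ?thesis by (simp add: coeff_sum mult.commute)
  qed
  then show ?thesis by (intro exI[of _ "\<lambda>n. coeff (L n) 1"]) blast
qed

section \<open>Tensor powers of 2x2 matrices and their span\<close>

lemma tensor_power_Nil [simp]: "tensor_power 0 g [] [] = 1"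
  by (simp add: tensor_power_def)

lemma tensor_power_Cons:
  assumes "a \<in> {0, 1}" "b \<in> {0, 1}" "i \<in> tidx d" "j \<in> tidx d"
  shows "tensor_power (Suc d) g (a # i) (b # j) = g a b * tensor_power d g i j"
  using assms 
  by (simp add: tensor_power_def prod.lessThan_Suc_shift del: prod.lessThan_Suc)

lemma tensor_power_cong:
  assumes "\<And>a b. a \<in> {0, 1} \<Longrightarrow> b \<in> {0, 1} \<Longrightarrow> g a b = h a b"
  shows "tensor_power d g = tensor_power d h"
proof (rule mat_supp_eqI[of d])
  fix i j assume "i \<in> tidx d" "j \<in> tidx d"
  then show "tensor_power d g i j = tensor_power d h i j"
  proof (induction rule: tidx_induct2)
    case (Cons d a b i j)
    then show ?case using assms[of a b] by (simp only: tensor_power_Cons)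
  qed simp
qed (rule mat_supp_tensor)+

definition mm2 :: "(nat \<Rightarrow> nat \<Rightarrow> rat) \<Rightarrow> (nat \<Rightarrow> nat \<Rightarrow> rat) \<Rightarrow> nat \<Rightarrow> nat \<Rightarrow> rat" where
  "mm2 g h = (\<lambda>a b. g a 0 * h 0 b + g a 1 * h 1 b)"

lemma tensor_power_mult:
  "mat_mult d (tensor_power d g) (tensor_power d h) = tensor_power d (mm2 g h)"
proof (rule mat_supp_eqI[of d])
  fix i j assume "i \<in> tidx d" "j \<in> tidx d"
  then show "mat_mult d (tensor_power d g) (tensor_power d h) i j = tensor_power d (mm2 g h) i j"
  proof (induction rule: tidx_induct2)
    case Nil
    then show ?case by (simp add: mat_mult_def)
  next
    case (Cons d a b i j)
    have "mat_mult (Suc d) (tensor_power (Suc d) g) (tensor_power (Suc d) h) (a # i) (b # j)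
      = (\<Sum>w\<in>tidx d. mm2 g h a b * (tensor_power d g i w * tensor_power d h w j))"
      unfolding mat_mult_def sum_tidx_Suc using Cons.hyps
      by (intro sum.cong refl) (simp add: tensor_power_Cons mm2_def algebra_simps)
    also have "\<dots> = mm2 g h a b * mat_mult d (tensor_power d g) (tensor_power d h) i j"
      by (simp add: mat_mult_def sum_distrib_left)
    finally show ?case using Cons by (simp only: tensor_power_Cons)
  qed
qed (intro mat_supp_mult mat_supp_tensor)+

lemma tensor_power_diag:
  "tensor_power d (\<lambda>a b. if a = b then if a = 0 then x else y else 0)
    = (\<lambda>i j. if i = j \<and> i \<in> tidx d then x ^ count_list i 0 * y ^ (d - count_list i 0) else 0)"
proof (rule mat_supp_eqI[of d])
  fix i j assume "i \<in> tidx d" "j \<in> tidx d"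
  then show "tensor_power d (\<lambda>a b. if a = b then if a = 0 then x else y else 0) i j
      = (if i = j \<and> i \<in> tidx d then x ^ count_list i 0 * y ^ (d - count_list i 0) else 0)"
  proof (induction rule: tidx_induct2)
    case (Cons d a b i j)
    have "count_list i 0 \<le> d" using Cons.hyps count_le_length[of i 0] by (auto simp: tidx_def)
    with Cons show ?case by (auto simp: tensor_power_Cons Suc_diff_le)
  qed simp
qed (rule mat_supp_tensor, auto simp: mat_supp_def)

lemma tensor_power_id: "tensor_power d (\<lambda>a b. if a = b then 1 else 0) = mat_one d"
  using tensor_power_diag[of d 1 1] by (simp add: mat_one_def cong: if_cong)

definition transv :: "rat \<Rightarrow> (nat \<Rightarrow> nat \<Rightarrow> rat) \<Rightarrow> nat \<Rightarrow> nat \<Rightarrow> rat" where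
  "transv t X = (\<lambda>a b. (if a = b then 1 else 0) + t * X a b)"

text \<open>\<open>(1 + t E)^{\<otimes>d} = exp (t \<rho>(E))\<close> for a nilpotent matrix unit \<open>E\<close>.\<close>

lemma tensor_power_transv:
  assumes "p \<noteq> q"
  shows "tensor_power d (transv t (elem p q)) = (\<Sum>k\<le>d. mscale (t ^ k) (dpow p q d k))"
proof (rule mat_supp_eqI[of d])
  \<comment> \<open>The shift in the recursion uses the induction hypothesis at both
    \<open>n\<close> and \<open>n - 1\<close>, so the summation bound is left arbitrary above
    \<open>d\<close>.\<close>
  have *: "n \<ge> d \<Longrightarrow> tensor_power d (transv t (elem p q)) i j = (\<Sum>k\<le>n. t ^ k * dpow p q d k i j)"
    if "i \<in> tidx d" "j \<in> tidx d" for i j n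
    using that
  proof (induction arbitrary: n rule: tidx_induct2)
    case Nil
    have "(\<Sum>k\<le>n. t ^ k * dpow p q 0 k [] []) = (\<Sum>k\<le>n. if k = 0 then 1 else 0)"
      by (intro sum.cong) (auto simp: dpow_def)
    then show ?case by simp
  next
    case (Cons d a b i j)
    then obtain n' where n: "n = Suc n'" "n' \<ge> d" by (cases n) auto
    have "(\<Sum>k\<le>n. t ^ k * dpow p q (Suc d) k (a # i) (b # j))
      = (\<Sum>k\<le>n. if a = b then t ^ k * dpow p q d k i j else 0)
        + (\<Sum>k\<le>n. if a = p \<and> b = q \<and> k > 0 then t ^ k * dpow p q d (k - 1) i j else 0)"
      unfolding sum.distrib[symmetric] using Cons.hyps assms
      by (intro sum.cong) (auto simp: dpow_Cons algebra_simps)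
    also have "(\<Sum>k\<le>n. if a = b then t ^ k * dpow p q d k i j else 0)
      = (if a = b then tensor_power d (transv t (elem p q)) i j else 0)"
      using Cons.IH[of n] n by simp
    also have "(\<Sum>k\<le>n. if a = p \<and> b = q \<and> k > 0 then t ^ k * dpow p q d (k - 1) i j else 0)
      = (if a = p \<and> b = q then t * tensor_power d (transv t (elem p q)) i j else 0)"
      unfolding Cons.IH[OF n(2)] n(1) sum.atMost_Suc_shift
      by (cases "a = p \<and> b = q") (auto simp: sum_distrib_left mult.assoc)
    finally show ?case
      using Cons.hyps assms by (auto simp: tensor_power_Cons transv_def elem_def)
  qed
  fix i j assume "i \<in> tidx d" "j \<in> tidx d"
  with *[of i j d] show "tensor_power d (transv t (elem p q)) i j
      = (\<Sum>k\<le>d. mscale (t ^ k) (dpow p q d k)) i j"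
    by (simp add: sum_apply mscale_def)
next
  show "mat_supp d (\<Sum>k\<le>d. mscale (t ^ k) (dpow p q d k))"
    using mat_supp_dpow[of d p q]
    by (auto simp: mat_supp_def sum_apply mscale_def elim!: sum.not_neutral_contains_not_neutral)
qed (rule mat_supp_tensor)

lemma schur_algebra_span: "schur_algebra d = mat.span (tensor_power d ` {g. gl2 g})"
proof
  show "schur_algebra d \<subseteq> mat.span (tensor_power d ` {g. gl2 g})"
  proof
    fix M assume "M \<in> schur_algebra d"
    then obtain n :: nat and c g where g: "\<forall>k<n. gl2 (g k)"
      and M: "M = (\<lambda>i j. \<Sum>k<n. c k * tensor_power d (g k) i j)"
      unfolding schur_algebra_def by blast
    have "M = (\<Sum>k<n. mscale (c k) (tensor_power d (g k)))"
      unfolding M by (simp add: fun_eq_iff sum_apply mscale_def)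
    also have "\<dots> \<in> mat.span (tensor_power d ` {g. gl2 g})"
      using g by (intro mat.span_sum mat.span_scale mat.span_base) auto
    finally show "M \<in> mat.span (tensor_power d ` {g. gl2 g})" .
  qed
  show "mat.span (tensor_power d ` {g. gl2 g}) \<subseteq> schur_algebra d"
  proof
    fix M assume "M \<in> mat.span (tensor_power d ` {g. gl2 g})"
    then show "M \<in> schur_algebra d"
    proof (induction M rule: mat.span_induct_alt)
      case base
      show ?case unfolding schur_algebra_def
        by (intro CollectI exI[of _ "0::nat"]) (simp add: fun_eq_iff fun_apply)
    next
      case (step c x y)
      then obtain h n c' g where "gl2 h" "x = tensor_power d h" "\<forall>k<(n::nat). gl2 (g k)"
        "y = (\<lambda>i j. \<Sum>k<n. c' k * tensor_power d (g k) i j)"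
        unfolding schur_algebra_def by blast
      \<comment> \<open>The new summand is stored at index \<open>n\<close> by function update,
        leaving the indices below \<open>n\<close> unchanged.\<close>
      then have "(\<forall>k<Suc n. gl2 ((g(n := h)) k)) \<and> mscale c x + y =
          (\<lambda>i j. \<Sum>k<Suc n. (c'(n := c)) k * tensor_power d ((g(n := h)) k) i j)"
        by (auto simp: fun_eq_iff fun_apply mscale_def less_Suc_eq)
      then show ?case unfolding schur_algebra_def by blast
    qed
  qed
qed

lemma schur_mult:
  assumes "A \<in> schur_algebra d" "B \<in> schur_algebra d"
  shows "mat_mult d A B \<in> schur_algebra d"
  using assms(1) unfolding schur_algebra_span
proof (induction A rule: mat.span_induct_alt)
  case base
  then show ?case by (simp add: mat_mult_linear mat.span_zero)
next
  case (step c x y)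
  then obtain g where g: "gl2 g" "x = tensor_power d g" by auto
  have "mat_mult d x B \<in> mat.span (tensor_power d ` {g. gl2 g})"
    using assms(2) unfolding schur_algebra_span
  proof (induction B rule: mat.span_induct_alt)
    case base
    then show ?case by (simp add: mat_mult_linear mat.span_zero)
  next
    case (step c z B)
    then obtain h where h: "gl2 h" "z = tensor_power d h" by auto
    have det: "mm2 g h 0 0 * mm2 g h 1 1 - mm2 g h 0 1 * mm2 g h 1 0
        = (g 0 0 * g 1 1 - g 0 1 * g 1 0) * (h 0 0 * h 1 1 - h 0 1 * h 1 0)"
      unfolding mm2_def by algebra
    have "gl2 (mm2 g h)"
      using g(1) h(1) unfolding gl2_def det by simp
    then have "mat_mult d x z \<in> mat.span (tensor_power d ` {g. gl2 g})"
      unfolding g(2) h(2) tensor_power_mult by (intro mat.span_base) auto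
    with step show ?case
      by (simp add: mat_mult_linear mat.span_add mat.span_scale)
  qed
  with step show ?case
    by (simp add: mat_mult_linear mat.span_add mat.span_scale)
qed

text \<open>An entry is a product of linear polynomials in \<open>t\<close>. The constant
  coefficient is carried along because multiplying by a linear factor mixes it into the linear one,
  exactly as in the recursion of \<open>lie_entry\<close>.\<close>

lemma tensor_power_poly:
  assumes "i \<in> tidx d" "j \<in> tidx d"
  shows "\<exists>Q. degree Q \<le> d \<and> (\<forall>t. poly Q t = tensor_power d (transv t X) i j)
    \<and> coeff Q 0 = (if i = j then 1 else 0) \<and> coeff Q 1 = lie_rep d X i j"
  using assms
proof (induction rule: tidx_induct2)
  case Nil
  show ?case by (intro exI[of _ 1]) (simp add: lie_rep_def)
next
  case (Cons d a b i j)
  then obtain Q where Q: "degree Q \<le> d" "\<And>t. poly Q t = tensor_power d (transv t X) i j"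
    "coeff Q 0 = (if i = j then 1 else 0)" "coeff Q 1 = lie_rep d X i j" by blast
  let ?Q = "[:if a = b then 1 else 0, X a b:] * Q"
  have "degree ?Q \<le> Suc d"
    using degree_mult_le[of "[:if a = b then 1 else 0, X a b:]" Q] Q(1)
    by (auto split: if_splits)
  moreover have "poly ?Q t = tensor_power (Suc d) (transv t X) (a # i) (b # j)" for t
    using Cons.hyps by (simp add: tensor_power_Cons Q(2) transv_def distrib_right)
  moreover have "coeff ?Q 0 = (if a # i = b # j then 1 else 0)"
    using Q(3) by simp
  moreover have "coeff ?Q 1 = lie_rep (Suc d) X (a # i) (b # j)"
    using Cons.hyps Q(3,4) by (simp add: lie_rep_Cons)
  ultimately show ?case by blast
qed

text \<open>The sample parameters are nonnegative integers because \<open>1 + n E_11\<close> has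
  determinant \<open>1 + n\<close>, which is then nonzero.\<close>

lemma lie_rep_schur:
  assumes "\<And>n::nat. gl2 (transv (of_nat n) X)"
  shows "lie_rep d X \<in> schur_algebra d"
proof -
  obtain u where u: "\<And>Q :: rat poly. degree Q \<le> d \<Longrightarrow> coeff Q 1 = (\<Sum>n\<le>d. u n * poly Q (of_nat n))"
    using linear_coeff_functional[of d] by blast
  have "lie_rep d X i j = (\<Sum>n\<le>d. mscale (u n) (tensor_power d (transv (of_nat n) X))) i j" for i j
  proof (cases "i \<in> tidx d \<and> j \<in> tidx d")
    case True
    with tensor_power_poly[of i d j X] obtain Q where "degree Q \<le> d"
      "\<And>t. poly Q t = tensor_power d (transv t X) i j" "coeff Q 1 = lie_rep d X i j" by blast
    with u[of Q] show ?thesis by (simp add: sum_apply mscale_def)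
  qed (auto simp: lie_rep_def sum_apply mscale_def tensor_power_def)
  then have "lie_rep d X = (\<Sum>n\<le>d. mscale (u n) (tensor_power d (transv (of_nat n) X)))"
    by blast
  also have "\<dots> \<in> mat.span (tensor_power d ` {g. gl2 g})"
    using assms by (intro mat.span_sum mat.span_scale mat.span_base) auto
  finally show ?thesis by (simp add: schur_algebra_span)
qed

lemma rep_schur:
  assumes "p \<in> fa_carrier"
  shows "rep d p \<in> schur_algebra d"
proof -
  have gen: "lie_rep d (gen_elem x) \<in> schur_algebra d" for x
  proof (rule lie_rep_schur)
    have "1 + (of_nat n :: rat) \<noteq> 0" for n
      by (simp flip: of_nat_Suc)
    then show "gl2 (transv (of_nat n) (gen_elem x))" for n
      by (cases x) (simp_all add: gl2_def transv_def elem_def)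
  qed
  have one: "mat_one d \<in> schur_algebra d"
  proof -
    have "tensor_power d (\<lambda>a b. if a = b then 1 else 0) \<in> schur_algebra d"
      unfolding schur_algebra_span by (intro mat.span_base imageI) (simp add: gl2_def)
    then show ?thesis by (simp only: tensor_power_id)
  qed
  have word: "word_rep d w \<in> schur_algebra d" for w
    by (induction w) (simp_all add: one gen schur_mult)
  show ?thesis
    using assms
    by (induction p rule: fa_carrier_induct)
      (use word in \<open>simp_all add: rep_add rep_scale schur_algebra_span mat.span_zero mat.span_add
        mat.span_scale\<close>)
qed

section \<open>Surjectivity onto the Schur algebra\<close>

lemma rep_image_subspace: "mat.subspace (rep d ` fa_carrier)"
proof (rule mat.subspaceI)
  show "0 \<in> rep d ` fa_carrier" by (rule image_eqI[of _ _ 0]) simp_all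
next
  fix A B assume "A \<in> rep d ` fa_carrier" "B \<in> rep d ` fa_carrier"
  then show "A + B \<in> rep d ` fa_carrier" by (auto simp flip: rep_add)
next
  fix c A assume "A \<in> rep d ` fa_carrier"
  then show "mscale c A \<in> rep d ` fa_carrier" by (auto simp flip: rep_scale)
qed

lemma rep_image_mult:
  "A \<in> rep d ` fa_carrier \<Longrightarrow> B \<in> rep d ` fa_carrier \<Longrightarrow> mat_mult d A B \<in> rep d ` fa_carrier"
  by (auto simp flip: rep_mult)

lemma word_rep_image: "word_rep d w \<in> rep d ` fa_carrier"
  by (metis rep_mon fa_mon_carrier imageI)

text \<open>Factorials are invertible over the rationals, so the divided powers lie in the image,
  and with them the finite exponential sum.\<close>

lemma transv_image:
  assumes "gen_elem x = elem p q" "p \<noteq> q" "p \<in> {0, 1}" "q \<in> {0, 1}"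
  shows "tensor_power d (transv t (elem p q)) \<in> rep d ` fa_carrier"
proof -
  have "dpow p q d k \<in> rep d ` fa_carrier" for k
  proof -
    have "dpow p q d k = mscale (1 / fact k) (word_rep d (replicate k x))"
      unfolding word_rep_replicate[OF assms] by simp
    then show ?thesis
      using mat.subspace_scale[OF rep_image_subspace word_rep_image] by metis
  qed
  then show ?thesis
    unfolding tensor_power_transv[OF assms(2)]
    by (intro mat.subspace_sum mat.subspace_scale rep_image_subspace)
qed

text \<open>\<open>H_1\<close> acts diagonally with eigenvalues among \<open>0, ..., d\<close>, so a
  polynomial in it interpolating \<open>x^n y^(d-n)\<close> gives the diagonal tensor power.\<close>

lemma diag_image:
  "tensor_power d (\<lambda>a b. if a = b then if a = 0 then x else y else 0) \<in> rep d ` fa_carrier"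
proof -
  obtain P :: "rat poly" where P: "\<And>n. n \<le> d \<Longrightarrow> poly P (of_nat n) = x ^ n * y ^ (d - n)"
    using interpolation[of d "\<lambda>n. x ^ n * y ^ (d - n)"] by blast
  have "count_list i 0 \<le> d" if "i \<in> tidx d" for i
    using that count_le_length[of i 0] by (auto simp: tidx_def)
  then have "tensor_power d (\<lambda>a b. if a = b then if a = 0 then x else y else 0)
      = (\<Sum>k\<le>degree P. mscale (coeff P k) (word_rep d (replicate k Gh)))"
    unfolding tensor_power_diag
    by (auto simp: fun_eq_iff sum_apply mscale_def word_rep_h poly_altdef
        simp flip: P intro!: sum.neutral)
  also have "\<dots> \<in> rep d ` fa_carrier"
    by (intro mat.subspace_sum mat.subspace_scale rep_image_subspace word_rep_image)
  finally show ?thesis .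
qed

text \<open>Gaussian elimination with pivot \<open>g 0 0\<close> factors \<open>g\<close> into lower
  unipotent, diagonal and upper unipotent parts.\<close>

lemma tensor_power_image_00:
  assumes "gl2 g" "g 0 0 \<noteq> 0"
  shows "tensor_power d g \<in> rep d ` fa_carrier"
proof -
  define u v D where "u = g 1 0 / g 0 0" and "v = g 0 1 / g 0 0"
    and "D = g 1 1 - g 1 0 * g 0 1 / g 0 0"
  let ?L = "transv u (elem 1 0)" and ?U = "transv v (elem 0 1)"
  let ?D = "\<lambda>a b::nat. if a = b then if a = 0 then g 0 0 else D else 0"
  have "tensor_power d g = tensor_power d (mm2 ?L (mm2 ?D ?U))"
    using assms(2)
    by (intro tensor_power_cong)
      (auto simp: mm2_def transv_def elem_def u_def v_def D_def field_simps)
  also have "\<dots> = mat_mult d (tensor_power d ?L) (mat_mult d (tensor_power d ?D) (tensor_power d ?U))"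
    by (simp only: tensor_power_mult)
  also have "\<dots> \<in> rep d ` fa_carrier"
    by (intro rep_image_mult diag_image transv_image[of Ge] transv_image[of Gf]) simp_all
  finally show ?thesis .
qed

lemma tensor_power_image:
  assumes "gl2 g"
  shows "tensor_power d g \<in> rep d ` fa_carrier"
proof (cases "g 0 0 = 0")
  case False
  with assms show ?thesis by (rule tensor_power_image_00)
next
  case True
  \<comment> \<open>Adding the second row to the first makes the pivot \<open>g 1 0\<close>, which
    is nonzero because the determinant is.\<close>
  let ?g = "mm2 (transv 1 (elem 0 1)) g"
  have "gl2 ?g" "?g 0 0 \<noteq> 0"
    using assms True by (auto simp: gl2_def mm2_def transv_def elem_def)
  then have "tensor_power d ?g \<in> rep d ` fa_carrier" by (rule tensor_power_image_00)
  moreover have "tensor_power d g = tensor_power d (mm2 (transv (- 1) (elem 0 1)) ?g)"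
    by (intro tensor_power_cong) (auto simp: mm2_def transv_def elem_def)
  ultimately show ?thesis
    unfolding tensor_power_mult[symmetric, of d "transv (- 1) (elem 0 1)"]
    by (auto intro!: rep_image_mult transv_image[of Ge])
qed

lemma rep_image: "rep d ` fa_carrier = schur_algebra d"
proof
  show "rep d ` fa_carrier \<subseteq> schur_algebra d" using rep_schur by blast
  show "schur_algebra d \<subseteq> rep d ` fa_carrier"
    unfolding schur_algebra_span
    by (intro mat.span_minimal rep_image_subspace) (auto simp: tensor_power_image)
qed

text \<open>Modulo the ideal, a kernel element is a combination of ordered monomials that still maps
  to 0; independence then makes all its coefficients vanish.\<close>

lemma rep_kernel: "{p \<in> fa_carrier. rep d p = 0} = fa_ideal (rels d)"
proof
  show "fa_ideal (rels d) \<subseteq> {p \<in> fa_carrier. rep d p = 0}"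
    using rep_ideal fa_ideal_carrier[OF rels_carrier] by blast
  show "{p \<in> fa_carrier. rep d p = 0} \<subseteq> fa_ideal (rels d)"
  proof safe
    fix p assume p: "p \<in> fa_carrier" "rep d p = 0"
    then obtain c where c: "p - pbw_comb d c \<in> fa_ideal (rels d)"
      using pbw_spanning by blast
    from rep_ideal[OF c] p have "rep d (pbw_comb d c) = 0"
      by (simp add: rep_diff pbw_comb_carrier)
    then have "c (a, b, k) = 0" if "a + b + k \<le> d" for a b k
      using that by (rule pbw_independent)
    then have "pbw_comb d c = 0"
      unfolding pbw_comb_sum by (intro sum.neutral) auto
    with c show "p \<in> fa_ideal (rels d)" by simp
  qed
qed

text \<open>By the homomorphism theorem the first conjunct is the isomorphism of the presented
  algebra with the Schur algebra. The other two say that the ordered monomials span and are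
  independent modulo the ideal.\<close>

theorem theorem2p2:
  fixes d :: nat
  shows "(\<exists>\<psi>. fa_alg_hom d \<psi> \<and> \<psi> ` fa_carrier = schur_algebra d \<and>
            {p \<in> fa_carrier. \<psi> p = (\<lambda>_ _. 0)} = fa_ideal (rels d))
       \<and> (\<forall>p\<in>fa_carrier. \<exists>c :: nat \<times> nat \<times> nat \<Rightarrow> rat.
            fa_diff p (\<lambda>w. \<Sum>(a,b,k)\<in>{(a,b,k). a + b + k \<le> d}. c (a,b,k) * pbw_mon a b k w)
              \<in> fa_ideal (rels d))
       \<and> (\<forall>c :: nat \<times> nat \<times> nat \<Rightarrow> rat.
            (\<lambda>w. \<Sum>(a,b,k)\<in>{(a,b,k). a + b + k \<le> d}. c (a,b,k) * pbw_mon a b k w) \<in> fa_ideal (rels d)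
            \<longrightarrow> (\<forall>a b k. a + b + k \<le> d \<longrightarrow> c (a,b,k) = 0))"
proof -
  have zero: "(\<lambda>_ _. 0) = (0 :: mat)" by (simp add: fun_eq_iff fun_apply)
  have "fa_alg_hom d (rep d)"
    by (auto simp: fa_alg_hom_def fa_ops rep_add rep_scale rep_mult rep_one fun_eq_iff fun_apply
        mscale_def)
  then show ?thesis
    \<comment> \<open>For the last conjunct, a combination in the ideal is sent to 0 by
      \<open>rep d\<close>, so \<open>pbw_independent\<close> applies.\<close>
    unfolding fa_ops zero pbw_comb_def[symmetric]
    by (intro conjI exI[of _ "rep d"] ballI allI impI rep_image rep_kernel pbw_spanning)
      (auto intro: pbw_independent rep_ideal)
qed

end
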